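(* Let $p$ be a prime. Then the automorphism group $\mathrm{Aut}(G)$ of the directed graph $G=G(p^2,p,1+p)$ is a nonabelian group of order $p^{p+1}\cdot(p-1)$. Moreover, it is a semidirect product $N\rtimes H$ (i.e. $N,H$ are subgroups of $\mathrm{Aut}(G)$ with $N$ normal, $N\cap H=1$ and $NH=\mathrm{Aut}(G)$), where (1) $N$ is a normal, elementary abelian subgroup of order $p^p$, and (2) $H$ is a complementary subgroup of order $p\cdot(p-1)$ isomorphic to $\mathrm{Aff}(\mathbb{F}_p)$.
   Context: For a positive integer $k$ and an element $w$ of multiplicative order $c$ in $\mathbb{Z}/k\mathbb{Z}$ (so $w$ is a unit mod $k$) with $c\mid k$, the directed graph $G(k,c,w)$ (loops allowed) has vertex set $\mathbb{Z}/k\mathbb{Z}\times\mathbb{Z}/k\mathbb{Z}$, and its edges are all the directed edges $(u,i)\to(u+w^j i,\,j)$ with $u,i,j\in\mathbb{Z}/k\mathbb{Z}$. Here $w^j$ for $j\in\mathbb{Z}/k\mathbb{Z}$ is well defined because $c\mid k$. The element $1+p$ has multiplicative order $p$ in $\mathbb{Z}/p^2\mathbb{Z}$. $\mathrm{Aff}(\mathbb{F}_p)$ is the group under composition of the maps $x\mapsto mx+b$ on $\mathbb{F}_p$ with $m\in\mathbb{F}_p^\times$, $b\in\mathbb{F}_p$. *)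

theory Defs
  imports
    "Graph_Theory.Graph_Theory"
    "HOL-Number_Theory.Number_Theory"
    "HOL-Algebra.Bij"
begin

text \<open>
  The ring Z/kZ is represented by the natural numbers below \<open>k\<close>.  The parameter \<open>c\<close> does not
  occur in the body: it is the multiplicative order of \<open>w\<close> modulo \<open>k\<close>, and only its divisibility
  \<open>c dvd k\<close> matters, which makes \<open>w ^ j mod k\<close> independent of the chosen representative of the
  residue class of \<open>j\<close> (lemma \<open>power_well_defined\<close>).
\<close>

definition residue_digraph :: "nat \<Rightarrow> nat \<Rightarrow> nat \<Rightarrow> (nat \<times> nat) pair_pre_digraph" where
  "residue_digraph k c w =
     \<lparr>pverts = {..<k} \<times> {..<k},
      parcs = {((u, i), ((u + w ^ j * i) mod k, j)) | u i j. u < k \<and> i < k \<and> j < k}\<rparr>"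

definition admissible :: "nat \<Rightarrow> nat \<Rightarrow> nat \<Rightarrow> bool" where
  "admissible k c w \<longleftrightarrow> 0 < k \<and> coprime k w \<and> ord k w = c \<and> c dvd k"

lemma power_well_defined:
  assumes "admissible k c w" and "[i = j] (mod k)"
  shows "[w ^ i = w ^ j] (mod k)"
proof -
  have "[i = j] (mod ord k w)"
    using assms cong_dvd_modulus_nat unfolding admissible_def by blast
  then show ?thesis
    using assms(1) order_divides_expdiff[of k w i j] unfolding admissible_def by blast
qed

lemma pair_fin_digraph_residue_digraph: "pair_fin_digraph (residue_digraph k c w)"
proof
  show "finite (pverts (residue_digraph k c w))"
    by (simp add: residue_digraph_def)
  have "parcs (residue_digraph k c w) \<subseteq> ({..<k} \<times> {..<k}) \<times> ({..<k} \<times> {..<k})"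
    by (auto simp: residue_digraph_def)
  then show "finite (parcs (residue_digraph k c w))"
    by (rule finite_subset) simp
qed (auto simp: residue_digraph_def)

lemma one_plus_p_power:
  fixes p n :: nat
  shows "[(1 + p) ^ n = 1 + n * p] (mod p\<^sup>2)"
proof (induction n)
  case 0
  show ?case by simp
next
  case (Suc n)
  have "[(1 + p) * (1 + p) ^ n = (1 + p) * (1 + n * p)] (mod p\<^sup>2)"
    by (rule cong_scalar_left[OF Suc])
  also have "(1 + p) * (1 + n * p) = (1 + Suc n * p) + n * p\<^sup>2"
    by (simp add: algebra_simps power2_eq_square)
  also have "[\<dots> = 1 + Suc n * p] (mod p\<^sup>2)"
    by (simp add: cong_def)
  finally show ?case by simp
qed

lemma admissible_prime:
  assumes "prime p"
  shows "admissible (p\<^sup>2) p (1 + p)"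
proof -
  have p1: "p > 1" using assms prime_gt_1_nat by blast
  have cop: "coprime (p\<^sup>2) (1 + p)"
    by simp
  have "[1 + p * p = 1] (mod p\<^sup>2)"
    unfolding cong_def power2_eq_square by (rule mod_add_self2)
  then have "[(1 + p) ^ p = 1] (mod p\<^sup>2)"
    using one_plus_p_power[of p p] cong_trans by blast
  then have "ord (p\<^sup>2) (1 + p) dvd p"
    using ord_divides by blast
  moreover have "ord (p\<^sup>2) (1 + p) \<noteq> 1"
  proof
    assume "ord (p\<^sup>2) (1 + p) = 1"
    then have "[(1 + p) ^ 1 = 1] (mod p\<^sup>2)"
      using ord_divides[of "1 + p" 1 "p\<^sup>2"] by simp
    then have "p\<^sup>2 dvd p"
      using cong_add_lcancel_0_nat[of 1 p "p\<^sup>2"] by (simp add: cong_0_iff)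
    then show False
      using p1 by (auto simp: power2_eq_square dest: dvd_imp_le)
  qed
  ultimately have "ord (p\<^sup>2) (1 + p) = p"
    using assms by (auto simp: prime_nat_iff)
  then show ?thesis
    using cop p1 by (simp add: admissible_def)
qed

definition digraph_auts :: "'a pair_pre_digraph \<Rightarrow> ('a \<Rightarrow> 'a) set" where
  "digraph_auts G =
     {f \<in> Bij (pverts G). \<forall>u\<in>pverts G. \<forall>v\<in>pverts G. (u, v) \<in> parcs G \<longleftrightarrow> (f u, f v) \<in> parcs G}"

definition digraph_AutGroup :: "'a pair_pre_digraph \<Rightarrow> ('a \<Rightarrow> 'a) monoid" where
  "digraph_AutGroup G = BijGroup (pverts G) \<lparr>carrier := digraph_auts G\<rparr>"

text \<open>
  The library's digraph isomorphisms also carry a map on arcs.  Without parallel arcs that map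
  is determined by the one on vertices, so the automorphisms above are the vertex parts of the
  isomorphisms from \<open>G\<close> to itself.
\<close>

lemma digraph_auts_iff_digraph_isomorphism:
  assumes "pair_wf_digraph G"
  shows "f \<in> digraph_auts G \<longleftrightarrow>
    f \<in> extensional (pverts G) \<and>
    (\<exists>h. pre_digraph.digraph_isomorphism (with_proj G) h \<and>
         app_iso h (with_proj G) = with_proj G \<and> (\<forall>v\<in>pverts G. iso_verts h v = f v))"
    (is "?L \<longleftrightarrow> ?R")
proof -
  interpret pair_wf_digraph G by (rule assms)
  have wf: "wf_digraph (with_proj G)" by unfold_locales
  show ?thesis
  proof
    assume L: ?L
    then have f: "inj_on f (pverts G)" "f ` pverts G = pverts G" "f \<in> extensional (pverts G)"
      and pres: "\<And>u v. u \<in> pverts G \<Longrightarrow> v \<in> pverts G \<Longrightarrow>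
                   (u, v) \<in> parcs G \<longleftrightarrow> (f u, f v) \<in> parcs G"
      by (auto simp: digraph_auts_def Bij_def bij_betw_def)
    define h where "h = \<lparr>iso_verts = f, iso_arcs = map_prod f f,
      iso_head = (snd :: 'a \<times> 'a \<Rightarrow> 'a), iso_tail = fst\<rparr>"
    have sub: "parcs G \<subseteq> pverts G \<times> pverts G"
      by (auto dest: in_arcsD1 in_arcsD2)
    have "inj_on (map_prod f f) (parcs G)"
      using map_prod_inj_on[OF f(1) f(1)] sub inj_on_subset by blast
    then have iso: "pre_digraph.digraph_isomorphism (with_proj G) h"
      using wf f by (auto simp: pre_digraph.digraph_isomorphism_def h_def)
    have "map_prod f f ` parcs G = parcs G"
    proof
      show "map_prod f f ` parcs G \<subseteq> parcs G"
        using pres sub by auto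
      show "parcs G \<subseteq> map_prod f f ` parcs G"
      proof
        fix e assume e: "e \<in> parcs G"
        have "fst e \<in> f ` pverts G" "snd e \<in> f ` pverts G"
          using e f(2) arc_fst_in_verts arc_snd_in_verts by simp_all
        then obtain u v where uv: "u \<in> pverts G" "v \<in> pverts G" "fst e = f u" "snd e = f v"
          by (elim imageE)
        have "e = map_prod f f (u, v)"
          using uv by (simp add: prod_eq_iff)
        moreover have "(u, v) \<in> parcs G"
          using e uv pres[of u v] by (metis prod.collapse)
        ultimately show "e \<in> map_prod f f ` parcs G" by (rule image_eqI)
      qed
    qed
    then have "app_iso h (with_proj G) = with_proj G"
      using f(2) by (simp add: app_iso_def with_proj_def h_def)
    then show ?R
      using iso f(3) by (auto simp: h_def)
  next
    assume ?R
    then obtain h where ext: "f \<in> extensional (pverts G)"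
      and iso: "pre_digraph.digraph_isomorphism (with_proj G) h"
      and app: "app_iso h (with_proj G) = with_proj G"
      and hf: "\<And>v. v \<in> pverts G \<Longrightarrow> iso_verts h v = f v" by blast
    have app': "iso_verts h ` pverts G = pverts G" "iso_arcs h ` parcs G = parcs G"
      "iso_tail h = fst" "iso_head h = snd"
      using app by (simp_all add: app_iso_def with_proj_def)
    have injv: "inj_on (iso_verts h) (pverts G)"
      and ends: "\<And>a. a \<in> parcs G \<Longrightarrow> iso_arcs h a = (f (fst a), f (snd a))"
      using iso app' hf arc_fst_in_verts arc_snd_in_verts
      by (auto simp: pre_digraph.digraph_isomorphism_def prod_eq_iff)
    have injf: "inj_on f (pverts G)"
      using injv hf by (auto simp: inj_on_def)
    have "f ` pverts G = pverts G"
      using app'(1) hf by auto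
    moreover have "(u, v) \<in> parcs G \<longleftrightarrow> (f u, f v) \<in> parcs G"
      if uv: "u \<in> pverts G" "v \<in> pverts G" for u v
    proof
      assume "(u, v) \<in> parcs G"
      then show "(f u, f v) \<in> parcs G"
        using ends[of "(u, v)"] app'(2) by (metis fst_conv snd_conv imageI)
    next
      assume "(f u, f v) \<in> parcs G"
      then obtain a where a: "a \<in> parcs G" "iso_arcs h a = (f u, f v)"
        using app'(2) by (metis imageE)
      then have "f (fst a) = f u" "f (snd a) = f v"
        using ends by auto
      then have "fst a = u" "snd a = v"
        using injf uv a(1) arc_fst_in_verts arc_snd_in_verts by (auto dest: inj_onD)
      then show "(u, v) \<in> parcs G"
        using a(1) by (metis prod.collapse)
    qed
    ultimately show ?L
      using ext injf by (auto simp: digraph_auts_def Bij_def bij_betw_def)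
  qed
qed

definition affine_maps :: "('a, 'b) ring_scheme \<Rightarrow> ('a \<Rightarrow> 'a) set" where
  "affine_maps R =
     {\<lambda>x\<in>carrier R. m \<otimes>\<^bsub>R\<^esub> x \<oplus>\<^bsub>R\<^esub> b | m b. m \<in> Units R \<and> b \<in> carrier R}"

definition Aff :: "('a, 'b) ring_scheme \<Rightarrow> ('a \<Rightarrow> 'a) monoid" where
  "Aff R = BijGroup (carrier R) \<lparr>carrier := affine_maps R\<rparr>"

definition elementary_abelian :: "nat \<Rightarrow> ('a, 'b) monoid_scheme \<Rightarrow> bool" where
  "elementary_abelian p G \<longleftrightarrow>
     comm_group G \<and> (\<forall>x\<in>carrier G. x \<noteq> \<one>\<^bsub>G\<^esub> \<longrightarrow> group.ord G x = p)"

end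

theory Submission
  imports Defs
begin

text \<open>
  Write \<open>K = p\<^sup>2\<close>.  Since \<open>(1 + p)\<^sup>j \<equiv> 1 + j p\<close> modulo \<open>K\<close>, the arcs are
  \<open>(u, i) \<rightarrow> (u + i + p i j, j)\<close>, and in particular \<open>(u, i)\<close> carries a loop exactly when \<open>i = 0\<close>.

  An automorphism \<open>f = (P, Q)\<close> preserves loops, so \<open>Q u 0 = 0\<close>.  The out-neighbours of \<open>(u, 0)\<close> are
  the vertices \<open>(u, j)\<close>, which forces \<open>P u j = U u\<close> independently of \<open>j\<close>; the arc
  \<open>(u, i) \<rightarrow> (u + i, 0)\<close> then gives \<open>Q u i = U (u + i) - U u\<close>.  Thus \<open>f\<close> is determined by one
  permutation \<open>U\<close> of the residues modulo \<open>K\<close>: in the coordinates \<open>(u, u + i)\<close> it acts as \<open>U \<times> U\<close>.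
  What is left of the arc condition is
  \<open>U (v + p i j) \<equiv> U v + p (U v - U (v - i)) (U (v + j) - U v)\<close>.  The left-hand side depends on
  \<open>i j\<close> only, and comparing \<open>(1, -1)\<close> with \<open>(-1, 1)\<close> shows that consecutive differences of \<open>U\<close>
  agree modulo \<open>p\<close>.  Hence \<open>U x \<equiv> m x + b\<close> modulo \<open>p\<close> with \<open>m\<close> a unit, while within a residue
  class modulo \<open>p\<close> the map \<open>U\<close> stretches by \<open>m\<^sup>2\<close>: \<open>U (x + p t) \<equiv> U x + p m\<^sup>2 t\<close>
  (lemmas \<open>arc_preserving_int_maps\<close>, \<open>aut_is_diagonal_action\<close>).  Conversely every such \<open>U\<close> gives an automorphism (lemma
  \<open>diagonal_action_twisted_affine_aut\<close>).

  The group structure can now be read off.  Reducing \<open>U\<close> modulo \<open>p\<close> is a homomorphism onto the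
  affine group of the field with \<open>p\<close> elements.  It is split by the maps that
  act on the two base-\<open>p\<close> digits of \<open>x = a + p t\<close> without carry,
  \<open>a + p t \<mapsto> (m a + b mod p) + p (m\<^sup>2 t mod p)\<close>.  The kernel of the reduction consists of the maps
  \<open>x \<mapsto> x + p \<alpha> (x mod p)\<close> with an arbitrary function \<open>\<alpha>\<close> on the residues modulo \<open>p\<close>; composition
  adds these functions, so the kernel is elementary abelian of order \<open>p\<^sup>p\<close>.  A split surjection
  exhibits its source as a semidirect product (lemma \<open>split_epimorphism_semidirect\<close>).
\<close>

section \<open>Maps of integer pairs that preserve the arcs\<close>

lemma square_dvd_mult_cancel:
  fixes p :: int assumes "p \<noteq> 0" shows "p\<^sup>2 dvd p * x \<longleftrightarrow> p dvd x"
  using assms by (simp add: power2_eq_square)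

text \<open>
  The step from an automorphism to its normal form, for maps on all integers so that sums need no
  reduction.  Only congruences of the values are claimed, since the values are meant modulo \<open>p\<^sup>2\<close>.
\<close>

lemma arc_preserving_int_maps:
  fixes p :: int and P Q :: "int \<Rightarrow> int \<Rightarrow> int"
  assumes p: "prime p"
    and arcs: "\<And>u i v j. [v = u + i + p * i * j] (mod p\<^sup>2) \<longleftrightarrow>
                  [P v j = P u i + Q u i + p * Q u i * Q v j] (mod p\<^sup>2)"
  obtains m where "\<not> p dvd m"
    and "\<And>v j. [P v j = P v 0] (mod p\<^sup>2)"
    and "\<And>u i. [Q u i = P (u + i) 0 - P u 0] (mod p\<^sup>2)"
    and "\<And>x y. [P y 0 - P x 0 = m * (y - x)] (mod p)"
    and "\<And>x y. [x = y] (mod p) \<Longrightarrow> [P y 0 - P x 0 = m\<^sup>2 * (y - x)] (mod p\<^sup>2)"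
proof -
  define U where "U x = P x 0" for x
  have p0: "p \<noteq> 0" using p by auto
  have pp: "p dvd p\<^sup>2" by simp
  \<comment> \<open>The loop at \<open>(u, 0)\<close> is preserved, and the loop condition \<open>q + p q\<^sup>2 \<equiv> 0\<close> has the root \<open>0\<close> only.\<close>
  have Q0: "[Q u 0 = 0] (mod p\<^sup>2)" for u
  proof -
    have "[P u 0 = P u 0 + Q u 0 + p * Q u 0 * Q u 0] (mod p\<^sup>2)"
      using arcs[of u u 0 0] by simp
    then have "p\<^sup>2 dvd P u 0 - (P u 0 + Q u 0 + p * Q u 0 * Q u 0)"
      by (simp only: cong_iff_dvd_diff)
    also have "P u 0 - (P u 0 + Q u 0 + p * Q u 0 * Q u 0) = - (Q u 0 * (1 + p * Q u 0))"
      by (simp add: algebra_simps)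
    finally have "p\<^sup>2 dvd Q u 0 * (1 + p * Q u 0)"
      by (simp only: dvd_minus_iff)
    moreover have "coprime p (1 + p * Q u 0)"
      by (rule coprimeI) (metis dvd_add_left_iff dvd_mult2)
    then have "coprime (p\<^sup>2) (1 + p * Q u 0)"
      by simp
    ultimately show ?thesis
      by (simp add: coprime_dvd_mult_left_iff cong_0_iff)
  qed
  have PU: "[P v j = U v] (mod p\<^sup>2)" for v j
  proof -
    have "[P v j = P v 0 + Q v 0 + p * Q v 0 * Q v j] (mod p\<^sup>2)"
      using arcs[of v v 0 j] by simp
    also have "[P v 0 + Q v 0 + p * Q v 0 * Q v j = P v 0 + 0 + p * 0 * Q v j] (mod p\<^sup>2)"
      by (intro cong_add cong_mult cong_refl Q0)
    finally show ?thesis by (simp add: U_def)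
  qed
  have QU: "[Q u i = U (u + i) - U u] (mod p\<^sup>2)" for u i
  proof -
    have "[U (u + i) = P u i + Q u i + p * Q u i * Q (u + i) 0] (mod p\<^sup>2)"
      using arcs[of "u + i" u i 0] by (simp add: U_def)
    also have "[P u i + Q u i + p * Q u i * Q (u + i) 0 = U u + Q u i + p * Q u i * 0] (mod p\<^sup>2)"
      by (intro cong_add cong_mult cong_refl Q0 PU)
    finally have "[U (u + i) - U u = U u + Q u i - U u] (mod p\<^sup>2)"
      by (intro cong_diff) auto
    then show ?thesis by (simp add: cong_sym_eq)
  qed
  \<comment> \<open>\<open>(y, 0) \<rightarrow> (x, 0)\<close> is an arc exactly when \<open>x \<equiv> y\<close>, so arcs that are reflected make \<open>U\<close> injective.\<close>
  have inj: "[x = y] (mod p\<^sup>2)" if "[U x = U y] (mod p\<^sup>2)" for x y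
  proof -
    have "[P y 0 + 0 + p * 0 * Q x 0 = P y 0 + Q y 0 + p * Q y 0 * Q x 0] (mod p\<^sup>2)"
      by (intro cong_add cong_mult cong_refl cong_sym[OF Q0])
    then have "[P x 0 = P y 0 + Q y 0 + p * Q y 0 * Q x 0] (mod p\<^sup>2)"
      using that cong_trans by (simp add: U_def) blast
    then show ?thesis using arcs[of x y 0 0] by simp
  qed
  have rec: "[U (v + p * i * j) = U v + p * (U v - U (v - i)) * (U (v + p * i * j + j) - U (v + p * i * j))]
               (mod p\<^sup>2)" for v i j
  proof -
    let ?w = "v + p * i * j"
    have "[P ?w j = P (v - i) i + Q (v - i) i + p * Q (v - i) i * Q ?w j] (mod p\<^sup>2)"
      using arcs[of ?w "v - i" i j] by simp
    also have "[P (v - i) i + Q (v - i) i + p * Q (v - i) i * Q ?w j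
        = U (v - i) + (U (v - i + i) - U (v - i)) + p * (U (v - i + i) - U (v - i)) * (U (?w + j) - U ?w)]
        (mod p\<^sup>2)"
      by (intro cong_add cong_mult cong_refl QU PU)
    finally have "[P ?w j = U v + p * (U v - U (v - i)) * (U (?w + j) - U ?w)] (mod p\<^sup>2)"
      by simp
    then show ?thesis using PU[of ?w j] by (meson cong_sym cong_trans)
  qed
  have per: "[U (v + p * t) = U v] (mod p)" for v t
  proof -
    have "[U (v + p * t) = U v + p * (U v - U (v - 1)) * (U (v + p * t + t) - U (v + p * t))] (mod p)"
      using cong_dvd_modulus[OF rec[of v 1 t] pp] by simp
    moreover have "[U v + p * (U v - U (v - 1)) * (U (v + p * t + t) - U (v + p * t)) = U v + 0] (mod p)"
      by (intro cong_add cong_refl) (simp add: cong_0_iff mult.assoc)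
    ultimately show ?thesis
      using cong_trans by fastforce
  qed
  have A: "[U (v + p * i * j) = U v + p * ((U v - U (v - i)) * (U (v + j) - U v))] (mod p\<^sup>2)" for v i j
  proof -
    have 1: "[U (v + j + p * (i * j)) - U (v + p * (i * j)) = U (v + j) - U v] (mod p)"
      by (intro cong_diff per)
    have 2: "[(U v - U (v - i)) * (U (v + j + p * (i * j)) - U (v + p * (i * j)))
              = (U v - U (v - i)) * (U (v + j) - U v)] (mod p)"
      by (intro cong_mult cong_refl 1)
    have cp: "[p * a = p * b] (mod p\<^sup>2)" if "[a = b] (mod p)" for a b
      using that p0 by (simp add: cong_iff_dvd_diff square_dvd_mult_cancel flip: right_diff_distrib)
    have "[U (v + p * i * j) = U v + p * ((U v - U (v - i)) *
             (U (v + j + p * (i * j)) - U (v + p * (i * j))))] (mod p\<^sup>2)"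
      using rec[of v i j] by (simp only: mult.assoc add.commute add.left_commute add.assoc)
    then show ?thesis
      using cong_add[OF cong_refl[of "U v"] cp[OF 2]] by (rule cong_trans)
  qed
  \<comment> \<open>If \<open>U v \<equiv> U w\<close> modulo \<open>p\<close>, then \<open>A\<close> with \<open>i = v - w\<close>, \<open>j = 1\<close> says
     \<open>U (v + p (v - w)) \<equiv> U v\<close> modulo \<open>p\<^sup>2\<close>; injectivity descends to residues modulo \<open>p\<close>.\<close>
  have injp: "p dvd v - w" if "p dvd U v - U w" for v w
  proof -
    have "p\<^sup>2 dvd p * ((U v - U w) * (U (v + 1) - U v))"
      using that p0 by (subst square_dvd_mult_cancel) auto
    moreover have "[U (v + p * (v - w)) = U v + p * ((U v - U w) * (U (v + 1) - U v))] (mod p\<^sup>2)"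
      using A[of v "v - w" 1] by simp
    ultimately have "[U (v + p * (v - w)) = U v] (mod p\<^sup>2)"
      by (metis cong_add_lcancel_0 cong_0_iff cong_trans)
    then have "[v + p * (v - w) = v] (mod p\<^sup>2)" by (rule inj)
    then have "p\<^sup>2 dvd p * (v - w)" by (simp add: cong_iff_dvd_diff)
    then show ?thesis using p0 by (simp add: square_dvd_mult_cancel)
  qed
  define d where "d v = U (v + 1) - U v" for v
  have dunit: "\<not> p dvd d v" for v
  proof
    assume "p dvd d v"
    then have "p dvd (v + 1) - v" unfolding d_def by (rule injp)
    then show False using p by (simp add: prime_int_iff)
  qed
  \<comment> \<open>The pairs \<open>(i, j) = (1, -1)\<close> and \<open>(-1, 1)\<close> have the same product, which gives
     \<open>(d v)\<^sup>2 \<equiv> (d (v - 1))\<^sup>2\<close>.  The sign \<open>-1\<close> would identify \<open>U (v + 1)\<close> with \<open>U (v - 1)\<close> and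
     is therefore possible only for \<open>p = 2\<close>, where signs do not matter.\<close>
  have dstep: "[d v = d (v - 1)] (mod p)" for v
  proof -
    have "[U v + p * ((U v - U (v - 1)) * (U (v - 1) - U v)) =
           U v + p * ((U v - U (v + 1)) * (U (v + 1) - U v))] (mod p\<^sup>2)"
      using A[of v 1 "-1"] A[of v "-1" 1] by (simp add: cong_def)
    then have "p\<^sup>2 dvd p * (((U v - U (v - 1)) * (U (v - 1) - U v)) -
           ((U v - U (v + 1)) * (U (v + 1) - U v)))"
      by (simp add: cong_iff_dvd_diff right_diff_distrib)
    then have "p dvd (U v - U (v - 1)) * (U (v - 1) - U v) - (U v - U (v + 1)) * (U (v + 1) - U v)"
      using p0 by (simp add: square_dvd_mult_cancel)
    also have "(U v - U (v - 1)) * (U (v - 1) - U v) - (U v - U (v + 1)) * (U (v + 1) - U v)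
       = (d v - d (v - 1)) * (U (v + 1) - U (v - 1))"
      by (simp add: d_def algebra_simps)
    finally consider "p dvd d v - d (v - 1)" | "p dvd U (v + 1) - U (v - 1)"
      using p prime_dvd_mult_iff by blast
    then show ?thesis
    proof cases
      case 1 then show ?thesis by (simp add: cong_iff_dvd_diff)
    next
      case 2
      then have "p dvd (v + 1) - (v - 1)" by (rule injp)
      then have "p dvd 2" by simp
      then have "p dvd (U (v + 1) - U (v - 1)) - 2 * d (v - 1)"
        by (intro dvd_diff[OF 2] dvd_mult2)
      then show ?thesis by (simp add: cong_iff_dvd_diff d_def algebra_simps)
    qed
  qed
  define m where "m = d 0"
  have dm: "[d v = m] (mod p)" for v
  proof (induction v rule: int_induct[where k = 0])
    case base then show ?case by (simp add: m_def)
  next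
    case (step1 i) then show ?case using cong_trans[OF dstep[of "i + 1"]] by simp
  next
    case (step2 i) then show ?case using cong_trans[OF cong_sym[OF dstep[of i]]] by simp
  qed
  have lin0: "[U v = U 0 + m * v] (mod p)" for v
  proof (induction v rule: int_induct[where k = 0])
    case base then show ?case by simp
  next
    case (step1 i)
    have "[U i + d i = (U 0 + m * i) + m] (mod p)" by (intro cong_add step1 dm)
    then show ?case by (simp add: d_def algebra_simps)
  next
    case (step2 i)
    have "[U i - d (i - 1) = (U 0 + m * i) - m] (mod p)" by (intro cong_diff step2 dm)
    then show ?case by (simp add: d_def algebra_simps)
  qed
  have lin: "[U y - U x = m * (y - x)] (mod p)" for x y
    using cong_diff[OF lin0[of y] lin0[of x]] by (simp add: algebra_simps)
  have fib: "[U y - U x = m\<^sup>2 * (y - x)] (mod p\<^sup>2)" if "[x = y] (mod p)" for x y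
  proof -
    have "p dvd y - x" using that by (simp add: cong_iff_dvd_diff dvd_diff_commute)
    then obtain j where "y - x = p * j" by blast
    then have j: "y = x + p * j" by simp
    have "[(U x - U (x - 1)) * (U (x + j) - U x) = (m * (x - (x - 1))) * (m * (x + j - x))] (mod p)"
      by (intro cong_mult lin)
    then have "p\<^sup>2 dvd p * ((U x - U (x - 1)) * (U (x + j) - U x) - (m * (x - (x - 1))) * (m * (x + j - x)))"
      using p0 by (simp add: square_dvd_mult_cancel cong_iff_dvd_diff)
    then have "p\<^sup>2 dvd p * ((U x - U (x - 1)) * (U (x + j) - U x)) - m\<^sup>2 * (y - x)"
      by (simp add: j algebra_simps power2_eq_square)
    moreover have "p\<^sup>2 dvd U y - (U x + p * ((U x - U (x - 1)) * (U (x + j) - U x)))"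
      using A[of x 1 j] by (simp add: cong_iff_dvd_diff j)
    ultimately have "p\<^sup>2 dvd (p * ((U x - U (x - 1)) * (U (x + j) - U x)) - m\<^sup>2 * (y - x)) +
         (U y - (U x + p * ((U x - U (x - 1)) * (U (x + j) - U x))))"
      by (rule dvd_add)
    then show ?thesis by (simp add: cong_iff_dvd_diff algebra_simps)
  qed
  show thesis
  proof (rule that)
    show "\<not> p dvd m" unfolding m_def by (rule dunit)
  qed (use PU QU lin fib in \<open>simp_all only: U_def\<close>)
qed


section \<open>Split surjections, elementary abelian groups and automorphism groups\<close>

text \<open>
  A complement to the kernel is the image of the section: \<open>a = (a (s (\<phi> a))\<^sup>-\<^sup>1) (s (\<phi> a))\<close>.
\<close>

lemma split_epimorphism_semidirect:
  fixes A (structure)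
  assumes A: "group A" and Q: "group Q"
    and phi: "\<phi> \<in> hom A Q" and s: "s \<in> hom Q A"
    and sect: "\<forall>q\<in>carrier Q. \<phi> (s q) = q"
  shows "kernel A Q \<phi> \<lhd> A" and "subgroup (s ` carrier Q) A"
    and "kernel A Q \<phi> \<inter> s ` carrier Q = {\<one>}"
    and "kernel A Q \<phi> <#> s ` carrier Q = carrier A"
    and "A\<lparr>carrier := s ` carrier Q\<rparr> \<cong> Q"
    and "card (s ` carrier Q) = order Q"
    and "order A = card (kernel A Q \<phi>) * order Q"
proof -
  interpret A: group A by (rule A)
  interpret Q: group Q by (rule Q)
  interpret phi: group_hom A Q \<phi> by unfold_locales (rule phi)
  interpret s: group_hom Q A s by unfold_locales (rule s)
  let ?N = "kernel A Q \<phi>" and ?H = "s ` carrier Q"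
  show N: "?N \<lhd> A" by (rule phi.normal_kernel)
  show H: "subgroup ?H A" by (rule s.img_is_subgroup)
  have inj: "inj_on s (carrier Q)" by (metis inj_onI sect)
  show "?N \<inter> ?H = {\<one>}"
  proof
    show "?N \<inter> ?H \<subseteq> {\<one>}"
      using sect by (auto simp: kernel_def)
    show "{\<one>} \<subseteq> ?N \<inter> ?H"
      using H by (auto simp: kernel_def subgroup.one_closed)
  qed
  show "?N <#> ?H = carrier A"
  proof
    show "?N <#> ?H \<subseteq> carrier A"
      by (auto simp: set_mult_def kernel_def)
    show "carrier A \<subseteq> ?N <#> ?H"
    proof
      fix a assume a: "a \<in> carrier A"
      define h where "h = s (\<phi> a)"
      have h: "h \<in> carrier A" "\<phi> h = \<phi> a" "h \<in> ?H" using a sect by (auto simp: h_def)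
      have "a \<otimes> inv h \<in> ?N"
        using a h by (simp add: kernel_def)
      moreover have "a = (a \<otimes> inv h) \<otimes> h"
        using a h by (simp add: A.m_assoc)
      ultimately show "a \<in> ?N <#> ?H"
        using h(3) unfolding set_mult_def by blast
    qed
  qed
  have "s \<in> iso Q (A\<lparr>carrier := ?H\<rparr>)"
    using s inj by (auto simp: iso_def hom_def bij_betw_def)
  then show "A\<lparr>carrier := ?H\<rparr> \<cong> Q"
    using Q.iso_sym is_isoI by blast
  show "card ?H = order Q"
    using inj by (simp add: card_image order_def)
  have "\<phi> ` carrier A = carrier Q"
  proof
    show "carrier Q \<subseteq> \<phi> ` carrier A"
      using sect s.hom_closed by (metis image_eqI subsetI)
  qed auto
  then have "A Mod ?N \<cong> Q" by (rule phi.FactGroup_iso)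
  then have "card (carrier (A Mod ?N)) = card (carrier Q)" by (rule iso_same_card)
  then have "card (rcosets ?N) = order Q"
    by (simp add: FactGroup_def order_def)
  then show "order A = card ?N * order Q"
    using A.lagrange[OF normal_imp_subgroup[OF N]] by (simp add: mult.commute)
qed

lemma elementary_abelianI:
  assumes G: "group G" and p: "prime p"
    and comm: "\<And>x y. x \<in> carrier G \<Longrightarrow> y \<in> carrier G \<Longrightarrow> x \<otimes>\<^bsub>G\<^esub> y = y \<otimes>\<^bsub>G\<^esub> x"
    and pow: "\<And>x. x \<in> carrier G \<Longrightarrow> x [^]\<^bsub>G\<^esub> p = \<one>\<^bsub>G\<^esub>"
  shows "elementary_abelian p G"
proof -
  interpret group G by (rule G)
  have "group.ord G x = p" if x: "x \<in> carrier G" "x \<noteq> \<one>\<^bsub>G\<^esub>" for x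
  proof -
    have "ord x dvd p" using pow[OF x(1)] x(1) pow_eq_id by blast
    moreover have "ord x \<noteq> 1" using x ord_eq_1 by blast
    ultimately show ?thesis using p by (auto simp: prime_nat_iff)
  qed
  moreover have "comm_group G"
    by (rule group_comm_groupI) (rule comm)
  ultimately show ?thesis by (simp add: elementary_abelian_def)
qed

lemma BijGroup_mult: "f \<in> Bij S \<Longrightarrow> g \<in> Bij S \<Longrightarrow> f \<otimes>\<^bsub>BijGroup S\<^esub> g = compose S f g"
  by (simp add: BijGroup_def)

lemma subgroup_digraph_auts: "subgroup (digraph_auts G) (BijGroup (pverts G))"
proof (rule group.subgroupI[OF group_BijGroup])
  show "digraph_auts G \<subseteq> carrier (BijGroup (pverts G))"
    by (auto simp: digraph_auts_def BijGroup_def)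
  have "(\<lambda>x\<in>pverts G. x) \<in> digraph_auts G"
    by (simp add: digraph_auts_def id_Bij)
  then show "digraph_auts G \<noteq> {}" by blast
next
  fix f assume f: "f \<in> digraph_auts G"
  then have B: "f \<in> Bij (pverts G)" by (simp add: digraph_auts_def)
  let ?g = "restrict (inv_into (pverts G) f) (pverts G)"
  have gB: "?g \<in> Bij (pverts G)" using B by (rule restrict_inv_into_Bij)
  have cl: "?g u \<in> pverts G" and inv: "f (?g u) = u" if "u \<in> pverts G" for u
    using that B by (auto simp: Bij_inv_into_mem Bij_def bij_betw_inv_into_right)
  have "(u, v) \<in> parcs G \<longleftrightarrow> (?g u, ?g v) \<in> parcs G" if "u \<in> pverts G" "v \<in> pverts G" for u v
  proof -
    have "(?g u, ?g v) \<in> parcs G \<longleftrightarrow> (f (?g u), f (?g v)) \<in> parcs G"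
      using f cl[OF that(1)] cl[OF that(2)] unfolding digraph_auts_def by blast
    then show ?thesis by (simp only: inv[OF that(1)] inv[OF that(2)])
  qed
  then show "inv\<^bsub>BijGroup (pverts G)\<^esub> f \<in> digraph_auts G"
    using gB by (simp add: inv_BijGroup[OF B] digraph_auts_def)
next
  fix f g assume fg: "f \<in> digraph_auts G" "g \<in> digraph_auts G"
  then have B: "f \<in> Bij (pverts G)" "g \<in> Bij (pverts G)" by (auto simp: digraph_auts_def)
  moreover have "g u \<in> pverts G" if "u \<in> pverts G" for u
    using that Bij_imp_funcset[OF B(2)] by blast
  ultimately show "f \<otimes>\<^bsub>BijGroup (pverts G)\<^esub> g \<in> digraph_auts G"
    using fg by (auto simp: BijGroup_mult compose_Bij digraph_auts_def compose_eq)
qed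


section \<open>Automorphisms of the residue digraph as twisted affine maps\<close>

text \<open>
  Conjugating \<open>U \<times> U\<close> by the change of coordinates \<open>(u, i) \<mapsto> (u, u + i)\<close> gives this map.  The term
  \<open>k - U u\<close> stands for \<open>- U u\<close> modulo \<open>k\<close>, because subtraction of natural numbers truncates.
\<close>

definition diagonal_action :: "nat \<Rightarrow> (nat \<Rightarrow> nat) \<Rightarrow> nat \<times> nat \<Rightarrow> nat \<times> nat" where
  "diagonal_action k U =
     (\<lambda>(u, i)\<in>{..<k} \<times> {..<k}. (U u, (U ((u + i) mod k) + (k - U u)) mod k))"

lemma diagonal_action_apply:
  "u < k \<Longrightarrow> i < k \<Longrightarrow> diagonal_action k U (u, i) = (U u, (U ((u + i) mod k) + (k - U u)) mod k)"
  by (simp add: diagonal_action_def)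

lemma diagonal_action_in_extensional: "diagonal_action k U \<in> extensional ({..<k} \<times> {..<k})"
  by (simp add: diagonal_action_def)

lemma cong_snd_diagonal_action:
  assumes "u < k" "i < k" "U \<in> {..<k} \<rightarrow> {..<k}"
  shows "[int (snd (diagonal_action k U (u, i))) = int (U ((u + i) mod k)) - int (U u)] (mod int k)"
proof -
  have "U u < k" using assms by auto
  then have "int (U ((u + i) mod k) + (k - U u)) = int (U ((u + i) mod k)) - int (U u) + int k"
    by simp
  then have "int ((U ((u + i) mod k) + (k - U u)) mod k) = (int (U ((u + i) mod k)) - int (U u) + int k) mod int k"
    by (simp only: zmod_int)
  then show ?thesis
    using assms(1,2) by (simp add: diagonal_action_apply cong_def)
qed

lemma less_cong_int_unique:
  fixes a b k :: nat
  assumes "[int a = int b] (mod int k)" "a < k" "b < k"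
  shows "a = b"
  using assms by (metis cong_int_iff cong_less_modulus_unique_nat)

lemma cong_cong_right: "[b = c] (mod k) \<Longrightarrow> [a = b] (mod k) \<longleftrightarrow> [a = c] (mod k)"
  by (simp add: cong_def)

lemma diagonal_action_compose:
  assumes "U \<in> {..<k} \<rightarrow> {..<k}" "V \<in> {..<k} \<rightarrow> {..<k}"
  shows "diagonal_action k (compose {..<k} U V) =
         compose ({..<k} \<times> {..<k}) (diagonal_action k U) (diagonal_action k V)"
proof (rule extensionalityI[where A = "{..<k} \<times> {..<k}"])
  fix x assume "x \<in> {..<k} \<times> {..<k}"
  then obtain u i where x: "x = (u, i)" "u < k" "i < k" by auto
  define w where "w = (u + i) mod k"
  have w: "w < k" using x by (simp add: w_def)
  have V: "V u < k" "V w < k" using assms x w by auto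
  have "(V u + (V w + (k - V u)) mod k) mod k = (V u + (V w + (k - V u))) mod k"
    by (rule mod_add_right_eq)
  also have "V u + (V w + (k - V u)) = V w + k" using V by simp
  also have "(V w + k) mod k = V w" using V by simp
  finally have "(V u + (V w + (k - V u)) mod k) mod k = V w" .
  then show "diagonal_action k (compose {..<k} U V) x =
         compose ({..<k} \<times> {..<k}) (diagonal_action k U) (diagonal_action k V) x"
    using x V w by (simp add: diagonal_action_apply compose_eq w_def)
qed (simp_all add: diagonal_action_in_extensional compose_def)

text \<open>
  Affine with slope \<open>m\<close> modulo \<open>p\<close>, but with slope \<open>m\<^sup>2\<close> inside each residue class modulo \<open>p\<close>.
  The square comes from the term \<open>p i j\<close> in the arcs, in which both \<open>i\<close> and \<open>j\<close> are scaled by \<open>m\<close>.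
\<close>

definition twisted_affine :: "nat \<Rightarrow> int \<Rightarrow> (nat \<Rightarrow> nat) \<Rightarrow> bool" where
  "twisted_affine p m U \<longleftrightarrow>
     U \<in> extensional {..<p\<^sup>2} \<and> U \<in> {..<p\<^sup>2} \<rightarrow> {..<p\<^sup>2} \<and> \<not> int p dvd m \<and>
     (\<forall>x<p\<^sup>2. \<forall>y<p\<^sup>2. [int (U y) - int (U x) = m * (int y - int x)] (mod int p)) \<and>
     (\<forall>x<p\<^sup>2. \<forall>y<p\<^sup>2. [int x = int y] (mod int p) \<longrightarrow>
        [int (U y) - int (U x) = m\<^sup>2 * (int y - int x)] (mod (int p)\<^sup>2))"

locale prime_residue_digraph =
  fixes p :: nat
  assumes prime_p: "prime p"
begin

abbreviation "V \<equiv> {..<p\<^sup>2} \<times> {..<p\<^sup>2}"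
definition "G = residue_digraph (p\<^sup>2) p (1 + p)"
definition "A = digraph_AutGroup G"

lemma prime_int_p: "prime (int p)"
  using prime_p by simp

lemma p_ge_2: "2 \<le> p"
  using prime_p by (rule prime_ge_2_nat)

lemma p_le_square: "p \<le> p\<^sup>2"
  by (simp add: power2_eq_square)

lemma pverts_G: "pverts G = V"
  by (simp add: G_def residue_digraph_def)

text \<open>Replaces the power \<open>(1 + p)\<^sup>j\<close> by its first-order expansion.\<close>

lemma arc_iff_cong:
  assumes "u < p\<^sup>2" "i < p\<^sup>2" "v < p\<^sup>2" "j < p\<^sup>2"
  shows "((u, i), (v, j)) \<in> parcs G \<longleftrightarrow>
         [int v = int u + int i + int p * int i * int j] (mod (int p)\<^sup>2)"
proof -
  have "[u + (1 + p) ^ j * i = u + (1 + j * p) * i] (mod p\<^sup>2)"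
    by (intro cong_add cong_mult cong_refl one_plus_p_power)
  then have "(u + (1 + p) ^ j * i) mod p\<^sup>2 = (u + (1 + j * p) * i) mod p\<^sup>2"
    by (simp only: cong_def)
  then have "((u, i), (v, j)) \<in> parcs G \<longleftrightarrow> v = (u + (1 + j * p) * i) mod p\<^sup>2"
    using assms by (auto simp: G_def residue_digraph_def)
  also have "\<dots> \<longleftrightarrow> [v = u + (1 + j * p) * i] (mod p\<^sup>2)"
    using assms by (simp add: cong_def)
  also have "\<dots> \<longleftrightarrow> [int v = int (u + (1 + j * p) * i)] (mod int (p\<^sup>2))"
    by (simp only: cong_int_iff)
  also have "int (u + (1 + j * p) * i) = int u + int i + int p * int i * int j"
    by (simp add: algebra_simps)
  finally show ?thesis by simp
qed

text \<open>
  Equal values first force congruence modulo \<open>p\<close>, as \<open>m\<close> is a unit; only then does the slope \<open>m\<^sup>2\<close>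
  within the class apply and give congruence modulo \<open>p\<^sup>2\<close>.
\<close>

lemma twisted_affine_inj:
  assumes "twisted_affine p m U"
  shows "inj_on U {..<p\<^sup>2}"
proof (rule inj_onI)
  fix x y assume xy: "x \<in> {..<p\<^sup>2}" "y \<in> {..<p\<^sup>2}" "U x = U y"
  have m: "\<not> int p dvd m" using assms by (simp add: twisted_affine_def)
  have "[int (U y) - int (U x) = m * (int y - int x)] (mod int p)"
    using assms xy(1,2) unfolding twisted_affine_def by blast
  then have "[m * (int y - int x) = 0] (mod int p)"
    using xy(3) by (simp add: cong_sym_eq)
  then have "int p dvd int y - int x"
    using m prime_int_p by (simp add: cong_0_iff prime_dvd_mult_iff)
  then have "[int x = int y] (mod int p)"
    by (simp add: cong_iff_dvd_diff dvd_diff_commute)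
  then have "[int (U y) - int (U x) = m\<^sup>2 * (int y - int x)] (mod (int p)\<^sup>2)"
    using assms xy(1,2) unfolding twisted_affine_def by blast
  then have "[m\<^sup>2 * (int y - int x) = 0] (mod (int p)\<^sup>2)"
    using xy(3) by (simp add: cong_sym_eq)
  then have "(int p)\<^sup>2 dvd m\<^sup>2 * (int y - int x)"
    by (simp add: cong_0_iff)
  moreover have "coprime ((int p)\<^sup>2) (m\<^sup>2)"
    using m prime_int_p by (simp add: prime_imp_coprime)
  ultimately have "(int p)\<^sup>2 dvd int y - int x"
    by (simp add: coprime_dvd_mult_right_iff)
  then have "[int x = int y] (mod int (p\<^sup>2))"
    by (simp add: cong_iff_dvd_diff dvd_diff_commute)
  then show "x = y" using xy(1,2) by (intro less_cong_int_unique[of _ _ "p\<^sup>2"]) auto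
qed

text \<open>
  With \<open>w = u + i\<close>, the image arc condition reads \<open>U v \<equiv> U w + p m\<^sup>2 i j\<close>, because the second
  coordinates of the images are \<open>m i\<close> and \<open>m j\<close> modulo \<open>p\<close>.  Both this and the original condition
  \<open>v \<equiv> w + p i j\<close> imply \<open>v \<equiv> w\<close> modulo \<open>p\<close>, and inside that class they differ by the unit
  factor \<open>m\<^sup>2\<close>.
\<close>

lemma diagonal_action_twisted_affine_aut:
  assumes U: "twisted_affine p m U"
  shows "diagonal_action (p\<^sup>2) U \<in> digraph_auts G"
proof -
  let ?k = "p\<^sup>2" and ?f = "diagonal_action (p\<^sup>2) U"
  have Uk: "U \<in> {..<?k} \<rightarrow> {..<?k}" and m: "\<not> int p dvd m"
    and lin: "\<And>x y. x < ?k \<Longrightarrow> y < ?k \<Longrightarrow> [int (U y) - int (U x) = m * (int y - int x)] (mod int p)"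
    and fib: "\<And>x y. x < ?k \<Longrightarrow> y < ?k \<Longrightarrow> [int x = int y] (mod int p) \<Longrightarrow>
                [int (U y) - int (U x) = m\<^sup>2 * (int y - int x)] (mod (int p)\<^sup>2)"
    using U by (simp_all add: twisted_affine_def)
  have k0: "0 < ?k" using p_ge_2 by simp
  have inV: "?f ` V \<subseteq> V"
    using Uk k0 by (auto simp: diagonal_action_apply)
  have sndk: "[int (snd (?f (u, i))) = int (U ((u + i) mod ?k)) - int (U u)] (mod (int p)\<^sup>2)"
    if "u < ?k" "i < ?k" for u i
    using cong_snd_diagonal_action[OF that Uk] by simp
  have sndp: "[int (snd (?f (u, i))) = m * int i] (mod int p)" if "u < ?k" "i < ?k" for u i
  proof -
    have "[int ((u + i) mod ?k) = int u + int i] (mod int p)"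
    proof -
      have "[(u + i) mod ?k = u + i] (mod p)"
        by (simp add: cong_def mod_mod_cancel)
      then show ?thesis by (metis cong_int_iff of_nat_add)
    qed
    then have step: "[m * (int ((u + i) mod ?k) - int u) = m * (int u + int i - int u)] (mod int p)"
      by (intro cong_mult cong_diff cong_refl)
    have "[int (snd (?f (u, i))) = int (U ((u + i) mod ?k)) - int (U u)] (mod int p)"
      by (rule cong_dvd_modulus[OF sndk[OF that]]) simp
    also have "[int (U ((u + i) mod ?k)) - int (U u) = m * (int ((u + i) mod ?k) - int u)] (mod int p)"
      using that k0 by (intro lin) auto
    also note step
    finally show ?thesis by simp
  qed
  have inj: "inj_on ?f V"
  proof (rule inj_onI)
    fix x y assume xy: "x \<in> V" "y \<in> V" "?f x = ?f y"
    obtain u i v j where uv: "x = (u, i)" "y = (v, j)" "u < ?k" "i < ?k" "v < ?k" "j < ?k"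
      using xy by (cases x, cases y) auto
    have "U u = U v" using xy uv by (simp add: diagonal_action_apply)
    then have u: "u = v" using twisted_affine_inj[OF U] uv by (auto dest: inj_onD)
    have "[int (U ((u + i) mod ?k)) - int (U u) = int (U ((u + j) mod ?k)) - int (U u)] (mod (int p)\<^sup>2)"
    proof -
      have "?f (u, i) = ?f (u, j)" using xy(3) unfolding uv(1,2) u .
      then show ?thesis
        using cong_trans[OF cong_sym[OF sndk[OF uv(3,4)]], of "int (U ((u + j) mod ?k)) - int (U u)"]
          sndk[OF uv(3,6)] by (simp only:)
    qed
    then have "[int (U ((u + i) mod ?k)) = int (U ((u + j) mod ?k))] (mod int ?k)"
      by (simp add: cong_iff_dvd_diff)
    then have "U ((u + i) mod ?k) = U ((u + j) mod ?k)"
      using Uk k0 by (intro less_cong_int_unique[of _ _ ?k]) auto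
    then have "(u + i) mod ?k = (u + j) mod ?k"
      using twisted_affine_inj[OF U] k0 by (auto dest: inj_onD)
    then have "[i = j] (mod ?k)"
      by (metis cong_add_lcancel_nat cong_def)
    then have "i = j" using uv cong_less_modulus_unique_nat by blast
    then show "x = y" using u uv by simp
  qed
  have "bij_betw ?f V V"
    using inj inV by (simp add: bij_betw_def endo_inj_surj)
  then have bij: "?f \<in> Bij V"
    by (simp add: Bij_def diagonal_action_in_extensional)
  have arcs: "((u, i), (v, j)) \<in> parcs G \<longleftrightarrow> (?f (u, i), ?f (v, j)) \<in> parcs G"
    if uv: "u < ?k" "i < ?k" "v < ?k" "j < ?k" for u i v j
  proof -
    define w where "w = (u + i) mod ?k"
    have w: "w < ?k" using k0 by (simp add: w_def)
    have wk: "[int w = int u + int i] (mod (int p)\<^sup>2)"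
      by (simp add: w_def cong_def zmod_int)
    define i' where "i' = snd (?f (u, i))"
    define j' where "j' = snd (?f (v, j))"
    have f: "?f (u, i) = (U u, i')" "?f (v, j) = (U v, j')" and ij: "i' < ?k" "j' < ?k"
      using uv k0 by (simp_all add: i'_def j'_def diagonal_action_apply)
    have U': "U u < ?k" "U v < ?k" using uv Uk by auto
    have "int p dvd (int i' * int j') - ((m * int i) * (m * int j))"
      using cong_mult[OF sndp[OF uv(1,2)] sndp[OF uv(3,4)]] unfolding i'_def j'_def
      by (simp add: cong_iff_dvd_diff)
    then have "(int p)\<^sup>2 dvd int p * ((int i' * int j') - ((m * int i) * (m * int j)))"
      using p_ge_2 by (simp add: square_dvd_mult_cancel)
    then have "[int p * int i' * int j' = int p * m\<^sup>2 * int i * int j] (mod (int p)\<^sup>2)"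
      by (simp add: cong_iff_dvd_diff algebra_simps power2_eq_square)
    then have "[int (U u) + int i' + int p * int i' * int j' =
           int (U u) + (int (U w) - int (U u)) + int p * m\<^sup>2 * int i * int j] (mod (int p)\<^sup>2)"
      using sndk[OF uv(1,2)] unfolding w_def i'_def by (intro cong_add cong_refl)
    then have "[int (U u) + int i' + int p * int i' * int j' =
           int (U w) + int p * m\<^sup>2 * int i * int j] (mod (int p)\<^sup>2)" by simp
    then have R: "(?f (u, i), ?f (v, j)) \<in> parcs G \<longleftrightarrow>
        [int (U v) = int (U w) + int p * m\<^sup>2 * int i * int j] (mod (int p)\<^sup>2)"
      unfolding f arc_iff_cong[OF U'(1) ij(1) U'(2) ij(2)] by (rule cong_cong_right)
    have "[int u + int i + int p * int i * int j = int w + int p * int i * int j] (mod (int p)\<^sup>2)"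
      by (intro cong_add cong_refl cong_sym[OF wk])
    then have L: "((u, i), (v, j)) \<in> parcs G \<longleftrightarrow>
        [int v = int w + int p * int i * int j] (mod (int p)\<^sup>2)"
      unfolding arc_iff_cong[OF uv] by (rule cong_cong_right)
    show ?thesis
    proof (cases "[int w = int v] (mod int p)")
      case True
      have "[int (U v) - int (U w) - int p * m\<^sup>2 * int i * int j =
             m\<^sup>2 * (int v - int w) - int p * m\<^sup>2 * int i * int j] (mod (int p)\<^sup>2)"
        using fib[OF w uv(3) True] by (intro cong_diff cong_refl)
      then have "(int p)\<^sup>2 dvd int (U v) - int (U w) - int p * m\<^sup>2 * int i * int j \<longleftrightarrow>
            (int p)\<^sup>2 dvd m\<^sup>2 * (int v - int w) - int p * m\<^sup>2 * int i * int j"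
        by (rule cong_dvd_iff)
      also have "m\<^sup>2 * (int v - int w) - int p * m\<^sup>2 * int i * int j =
            m\<^sup>2 * (int v - (int w + int p * int i * int j))"
        by (simp add: algebra_simps)
      also have "(int p)\<^sup>2 dvd \<dots> \<longleftrightarrow> (int p)\<^sup>2 dvd int v - (int w + int p * int i * int j)"
        using m prime_int_p by (simp add: coprime_dvd_mult_right_iff prime_imp_coprime)
      finally show ?thesis unfolding L R by (simp add: cong_iff_dvd_diff algebra_simps)
    next
      case False
      have drop_multiple: "int p dvd a" if "int p dvd a - int p * b" for a b
        using dvd_add[OF that dvd_triv_left[of "int p" b]] by simp
      have "int p dvd int v - int w" if "[int v = int w + int p * int i * int j] (mod (int p)\<^sup>2)"
      proof -
        have "[int v = int w + int p * int i * int j] (mod int p)"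
          by (rule cong_dvd_modulus[OF that]) simp
        then have "int p dvd (int v - int w) - int p * (int i * int j)"
          by (simp add: cong_iff_dvd_diff algebra_simps)
        then show ?thesis by (rule drop_multiple)
      qed
      moreover have "int p dvd int v - int w"
        if "[int (U v) = int (U w) + int p * m\<^sup>2 * int i * int j] (mod (int p)\<^sup>2)"
      proof -
        have "[int (U v) = int (U w) + int p * m\<^sup>2 * int i * int j] (mod int p)"
          by (rule cong_dvd_modulus[OF that]) simp
        then have "int p dvd (int (U v) - int (U w)) - int p * (m\<^sup>2 * int i * int j)"
          by (simp add: cong_iff_dvd_diff algebra_simps)
        then have "int p dvd int (U v) - int (U w)"
          by (rule drop_multiple)
        then have "int p dvd m * (int v - int w)"
          using lin[OF w uv(3)] by (simp add: cong_dvd_iff)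
        then show ?thesis using m prime_int_p by (simp add: prime_dvd_mult_iff)
      qed
      moreover have "\<not> int p dvd int v - int w"
        using False by (simp add: cong_iff_dvd_diff dvd_diff_commute)
      ultimately show ?thesis unfolding L R by blast
    qed
  qed
  show ?thesis
    unfolding digraph_auts_def pverts_G using bij arcs by auto
qed

text \<open>
  The automorphism is extended periodically to all integers, so that
  \<open>arc_preserving_int_maps\<close> applies.
\<close>

lemma aut_is_diagonal_action:
  assumes f: "f \<in> digraph_auts G"
  obtains m U where "twisted_affine p m U" "f = diagonal_action (p\<^sup>2) U"
proof -
  let ?k = "p\<^sup>2"
  let ?K = "(int p)\<^sup>2"
  have K: "int ?k = ?K" by simp
  have K0: "0 < ?K" using p_ge_2 by simp
  have fB: "f \<in> Bij V"
    and fa: "\<And>x y. x \<in> V \<Longrightarrow> y \<in> V \<Longrightarrow> (x, y) \<in> parcs G \<longleftrightarrow> (f x, f y) \<in> parcs G"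
    using f unfolding digraph_auts_def pverts_G by auto
  define r where "r x = nat (x mod ?K)" for x
  have r: "r x < ?k" "int (r x) = x mod ?K" for x
    using K0 K by (simp_all add: r_def nat_less_iff)
  define P where "P x i = int (fst (f (r x, r i)))" for x i
  define Q where "Q x i = int (snd (f (r x, r i)))" for x i
  have fV: "fst (f (x, i)) < ?k" "snd (f (x, i)) < ?k" if "x < ?k" "i < ?k" for x i
  proof -
    have "f (x, i) \<in> V" using Bij_imp_funcset[OF fB] that by blast
    then show "fst (f (x, i)) < ?k" "snd (f (x, i)) < ?k" by auto
  qed
  have arcs: "[v = u + i + int p * i * j] (mod ?K) \<longleftrightarrow>
      [P v j = P u i + Q u i + int p * Q u i * Q v j] (mod ?K)" for u i v j
  proof -
    have rc: "[int (r x) = x] (mod ?K)" for x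
      by (simp add: r cong_def)
    have "[int (r u) + int (r i) + int p * int (r i) * int (r j) = u + i + int p * i * j] (mod ?K)"
      by (intro cong_add cong_mult cong_refl rc)
    then have "[v = u + i + int p * i * j] (mod ?K) \<longleftrightarrow>
       [int (r v) = int (r u) + int (r i) + int p * int (r i) * int (r j)] (mod ?K)"
      using rc[of v] by (meson cong_sym cong_trans)
    also have "\<dots> \<longleftrightarrow> ((r u, r i), (r v, r j)) \<in> parcs G"
      by (simp only: arc_iff_cong[OF r(1) r(1) r(1) r(1)])
    also have "\<dots> \<longleftrightarrow> (f (r u, r i), f (r v, r j)) \<in> parcs G"
      using r by (intro fa) auto
    also have "\<dots> \<longleftrightarrow> ((fst (f (r u, r i)), snd (f (r u, r i))),
        (fst (f (r v, r j)), snd (f (r v, r j)))) \<in> parcs G" by simp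
    also have "\<dots> \<longleftrightarrow> [P v j = P u i + Q u i + int p * Q u i * Q v j] (mod ?K)"
      unfolding P_def Q_def by (rule arc_iff_cong) (intro fV r)+
    finally show ?thesis .
  qed
  obtain m where m: "\<not> int p dvd m"
    and PU: "\<And>v j. [P v j = P v 0] (mod ?K)"
    and QU: "\<And>u i. [Q u i = P (u + i) 0 - P u 0] (mod ?K)"
    and lin: "\<And>x y. [P y 0 - P x 0 = m * (y - x)] (mod int p)"
    and fib: "\<And>x y. [x = y] (mod int p) \<Longrightarrow> [P y 0 - P x 0 = m\<^sup>2 * (y - x)] (mod ?K)"
    using arc_preserving_int_maps[OF prime_int_p arcs] by metis
  define U where "U = (\<lambda>x\<in>{..<?k}. fst (f (x, 0)))"
  have k0: "0 < ?k" using p_ge_2 by simp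
  have rint: "r (int x) = x" if "x < ?k" for x
  proof -
    have "int x < ?K" using that K by (metis of_nat_less_iff)
    then show ?thesis by (simp add: r_def)
  qed
  have r0: "r 0 = 0" by (simp add: r_def)
  have PU0: "P (int x) 0 = int (U x)" if "x < ?k" for x
    using that by (simp add: P_def U_def rint r0)
  have Uk: "U \<in> {..<?k} \<rightarrow> {..<?k}"
    using fV k0 by (auto simp: U_def)
  have "twisted_affine p m U"
    unfolding twisted_affine_def
  proof (intro conjI allI impI)
    show "U \<in> extensional {..<?k}" by (simp add: U_def)
    show "U \<in> {..<?k} \<rightarrow> {..<?k}" by (rule Uk)
    show "\<not> int p dvd m" by (rule m)
  next
    fix x y assume "x < ?k" "y < ?k"
    then show "[int (U y) - int (U x) = m * (int y - int x)] (mod int p)"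
      using lin[of "int y" "int x"] by (simp only: PU0)
  next
    fix x y assume "x < ?k" "y < ?k" "[int x = int y] (mod int p)"
    then show "[int (U y) - int (U x) = m\<^sup>2 * (int y - int x)] (mod ?K)"
      using fib[of "int x" "int y"] by (simp only: PU0)
  qed
  moreover have "f = diagonal_action ?k U"
  proof (rule extensionalityI[where A = V])
    show "f \<in> extensional V" by (rule Bij_imp_extensional[OF fB])
    show "diagonal_action ?k U \<in> extensional V" by (rule diagonal_action_in_extensional)
    fix x assume "x \<in> V"
    then obtain u i where x: "x = (u, i)" "u < ?k" "i < ?k" by auto
    define w where "w = (u + i) mod ?k"
    have w: "w < ?k" using k0 by (simp add: w_def)
    have "[P (int u) (int i) = P (int u) 0] (mod ?K)" by (rule PU)
    then have "[int (fst (f (u, i))) = int (U u)] (mod int ?k)"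
      using x by (simp add: PU0 K) (simp add: P_def rint)
    then have 1: "fst (f (u, i)) = U u"
      using fV x Uk by (intro less_cong_int_unique[of _ _ ?k]) auto
    have "(int u + int i) mod ?K = int w"
      by (simp add: w_def zmod_int)
    then have "r (int u + int i) = w"
      by (simp only: r_def nat_int)
    then have "P (int u + int i) 0 = int (U w)"
      using w by (simp add: P_def r0 U_def)
    then have "[int (snd (f (u, i))) = int (U w) - int (U u)] (mod int ?k)"
      using QU[of "int u" "int i"] x by (simp add: PU0 K) (simp add: Q_def rint)
    moreover have "[int (snd (diagonal_action ?k U (u, i))) = int (U w) - int (U u)] (mod int ?k)"
      unfolding w_def by (rule cong_snd_diagonal_action[OF x(2,3) Uk])
    ultimately have "[int (snd (f (u, i))) = int (snd (diagonal_action ?k U (u, i)))] (mod int ?k)"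
      by (meson cong_sym cong_trans)
    then have 2: "snd (f (u, i)) = snd (diagonal_action ?k U (u, i))"
      using fV x k0 by (intro less_cong_int_unique[of _ _ ?k]) (simp_all add: diagonal_action_apply)
    show "f x = diagonal_action ?k U x"
      using 1 2 x(2,3) unfolding x(1) by (intro prod_eqI) (simp_all add: diagonal_action_apply)
  qed
  ultimately show thesis by (rule that)
qed


section \<open>Affine maps of the prime field\<close>

abbreviation "R \<equiv> residue_ring (int p)"

definition affine :: "int \<Rightarrow> int \<Rightarrow> int \<Rightarrow> int" where
  "affine m b = (\<lambda>x\<in>carrier R. (m * x + b) mod int p)"

lemma carrier_R: "carrier R = {0..int p - 1}"
  by (simp add: residue_ring_def)

lemma affine_apply: "0 \<le> x \<Longrightarrow> x < int p \<Longrightarrow> affine m b x = (m * x + b) mod int p"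
  by (simp add: affine_def carrier_R)

lemma affine_in_carrier: "x \<in> carrier R \<Longrightarrow> affine m b x \<in> carrier R"
  using p_ge_2 by (simp add: affine_def carrier_R)

lemma affine_cong:
  "[m = m'] (mod int p) \<Longrightarrow> [b = b'] (mod int p) \<Longrightarrow> affine m b = affine m' b'"
  unfolding affine_def
  by (intro restrict_ext) (metis cong_add cong_def cong_mult cong_refl)

text \<open>
  The parameters may be arbitrary integers.  Then composition of affine maps needs no reduction of
  the parameters, and they are determined modulo \<open>p\<close>.
\<close>

lemma affine_maps_R: "affine_maps R = {affine m b | m b. \<not> int p dvd m}"
proof -
  interpret residues_prime p R
    by unfold_locales (rule prime_p)
  have ops: "(\<lambda>x\<in>carrier R. m \<otimes>\<^bsub>R\<^esub> x \<oplus>\<^bsub>R\<^esub> b) = affine m b" for m b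
    unfolding affine_def by (intro restrict_ext) (simp add: res_add_eq res_mult_eq mod_simps)
  have ndvd: "m \<in> Units R \<longleftrightarrow> m \<in> carrier R \<and> \<not> int p dvd m" for m
    using p_ge_2 by (cases "m = 0") (auto simp: res_prime_units_eq carrier_R dest: zdvd_imp_le)
  show ?thesis
  proof (intro equalityI subsetI)
    fix g assume "g \<in> affine_maps R"
    then show "g \<in> {affine m b | m b. \<not> int p dvd m}"
      unfolding affine_maps_def ops using ndvd by blast
  next
    fix g assume "g \<in> {affine m b | m b. \<not> int p dvd m}"
    then obtain m b where g: "g = affine m b" "\<not> int p dvd m" by blast
    have "g = affine (m mod int p) (b mod int p)"
      unfolding g by (rule affine_cong) (simp_all add: cong_def)
    moreover have "m mod int p \<in> Units R" "b mod int p \<in> carrier R"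
      using g(2) p_ge_2 by (simp_all add: ndvd carrier_R dvd_mod_iff)
    ultimately show "g \<in> affine_maps R"
      unfolding affine_maps_def ops by blast
  qed
qed

lemma mod_affine: "(m * (x mod k) + b) mod k = (m * x + b) mod (k::int)"
  by (metis mod_add_left_eq mod_mult_right_eq)

lemma compose_affine:
  "compose (carrier R) (affine m b) (affine n c) = affine (m * n) (m * c + b)"
proof (rule extensionalityI[where A = "carrier R"])
  fix x assume x: "x \<in> carrier R"
  have "(m * ((n * x + c) mod int p) + b) mod int p = (m * n * x + (m * c + b)) mod int p"
    by (simp add: mod_affine) (simp add: algebra_simps)
  then show "compose (carrier R) (affine m b) (affine n c) x = affine (m * n) (m * c + b) x"
    using x affine_in_carrier[OF x] by (simp add: compose_eq affine_def)
qed (simp_all add: compose_def affine_def)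

lemma affine_eqD:
  assumes "affine m b = affine m' b'"
  shows "[m = m'] (mod int p)" "[b = b'] (mod int p)"
proof -
  have "affine m b 0 = affine m' b' 0" "affine m b 1 = affine m' b' 1"
    using assms by simp_all
  then have "[b = b'] (mod int p)" "[m + b = m' + b'] (mod int p)"
    using p_ge_2 by (simp_all add: affine_apply cong_def)
  then show "[m = m'] (mod int p)" "[b = b'] (mod int p)"
    using cong_diff by fastforce+
qed

lemma affine_Bij:
  assumes "\<not> int p dvd m"
  shows "affine m b \<in> Bij (carrier R)"
proof -
  have "inj_on (affine m b) (carrier R)"
  proof (rule inj_onI)
    fix x y assume xy: "x \<in> carrier R" "y \<in> carrier R" "affine m b x = affine m b y"
    then have "[m * x + b = m * y + b] (mod int p)"
      by (simp add: affine_def cong_def)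
    then have "int p dvd m * (x - y)"
      by (simp add: cong_iff_dvd_diff algebra_simps)
    then have "int p dvd x - y"
      using assms prime_int_p by (simp add: prime_dvd_mult_iff)
    then show "x = y"
      using xy(1,2) by (auto simp: carrier_R cong_iff_dvd_diff[symmetric] intro: cong_less_imp_eq_int)
  qed
  moreover have "finite (carrier R)" by (simp add: carrier_R)
  moreover have "affine m b ` carrier R \<subseteq> carrier R" using affine_in_carrier by blast
  ultimately have "bij_betw (affine m b) (carrier R) (carrier R)"
    by (simp add: bij_betw_def endo_inj_surj)
  then show ?thesis by (simp add: Bij_def affine_def)
qed

lemma card_affine_maps: "card (affine_maps R) = p * (p - 1)"
proof -
  have "affine_maps R = (\<lambda>(m, b). affine m b) ` ({1..<int p} \<times> {0..<int p})"
  proof (intro equalityI subsetI)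
    fix g assume "g \<in> affine_maps R"
    then obtain m b where g: "g = affine m b" "\<not> int p dvd m"
      by (auto simp: affine_maps_R)
    have "g = affine (m mod int p) (b mod int p)"
      unfolding g by (rule affine_cong) (simp_all add: cong_def)
    moreover have "m mod int p \<in> {1..<int p}"
      using g(2) p_ge_2 by (simp add: dvd_eq_mod_eq_0 order_neq_le_trans int_one_le_iff_zero_less)
    moreover have "b mod int p \<in> {0..<int p}"
      using p_ge_2 by simp
    ultimately show "g \<in> (\<lambda>(m, b). affine m b) ` ({1..<int p} \<times> {0..<int p})"
      by (intro image_eqI[where x = "(m mod int p, b mod int p)"]) auto
  next
    fix g assume "g \<in> (\<lambda>(m, b). affine m b) ` ({1..<int p} \<times> {0..<int p})"
    then obtain m b where g: "g = affine m b" "1 \<le> m" "m < int p" by auto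
    then have "\<not> int p dvd m" by (auto dest: zdvd_imp_le)
    then show "g \<in> affine_maps R" using g by (auto simp: affine_maps_R)
  qed
  moreover have "inj_on (\<lambda>(m, b). affine m b) ({1..<int p} \<times> {0..<int p})"
  proof (rule inj_onI)
    fix x y :: "int \<times> int"
    assume xy: "x \<in> {1..<int p} \<times> {0..<int p}" "y \<in> {1..<int p} \<times> {0..<int p}"
      "(\<lambda>(m, b). affine m b) x = (\<lambda>(m, b). affine m b) y"
    then have "affine (fst x) (snd x) = affine (fst y) (snd y)"
      by (simp add: case_prod_beta)
    from affine_eqD[OF this] show "x = y"
      using xy(1,2) by (auto simp: prod_eq_iff intro!: cong_less_imp_eq_int)
  qed
  ultimately have "card (affine_maps R) = card ({1..<int p} \<times> {0..<int p})"
    by (simp add: card_image)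
  also have "\<dots> = (p - 1) * p"
  proof -
    have "nat (int p - 1) = p - 1" by linarith
    then show ?thesis by (simp add: card_cartesian_product)
  qed
  finally show ?thesis by simp
qed


section \<open>Reduction modulo \<open>p\<close>\<close>

lemma carrier_A: "carrier A = digraph_auts G"
  by (simp add: A_def digraph_AutGroup_def)

lemma group_A: "group A"
  using group.subgroup_imp_group[OF group_BijGroup subgroup_digraph_auts[of G]]
  by (simp add: A_def digraph_AutGroup_def)

lemma mult_A:
  assumes "f \<in> carrier A" "g \<in> carrier A"
  shows "f \<otimes>\<^bsub>A\<^esub> g = compose V f g"
  using assms by (simp add: A_def digraph_AutGroup_def digraph_auts_def BijGroup_mult pverts_G)

lemma one_A: "\<one>\<^bsub>A\<^esub> = (\<lambda>x\<in>V. x)"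
  by (simp add: A_def digraph_AutGroup_def BijGroup_def pverts_G)

lemma diagonal_action_in_A: "twisted_affine p m U \<Longrightarrow> diagonal_action (p\<^sup>2) U \<in> carrier A"
  by (simp add: carrier_A diagonal_action_twisted_affine_aut)

lemma twisted_affine_funcset: "twisted_affine p m U \<Longrightarrow> U \<in> {..<p\<^sup>2} \<rightarrow> {..<p\<^sup>2}"
  by (simp add: twisted_affine_def)

lemma twisted_affine_unit: "twisted_affine p m U \<Longrightarrow> \<not> int p dvd m"
  by (simp add: twisted_affine_def)

lemma mult_diagonal_action:
  assumes "twisted_affine p m U" "twisted_affine p n W"
  shows "diagonal_action (p\<^sup>2) U \<otimes>\<^bsub>A\<^esub> diagonal_action (p\<^sup>2) W =
         diagonal_action (p\<^sup>2) (compose {..<p\<^sup>2} U W)"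
  using assms
  by (simp add: mult_A diagonal_action_in_A[of m] diagonal_action_in_A[of n] diagonal_action_compose
      twisted_affine_funcset)

text \<open>
  The permutation \<open>U\<close> is recovered from the automorphism as the first coordinate on the vertices
  with a loop.  Reduction is defined on the smallest representatives; for twisted affine \<open>U\<close>
  the choice is immaterial.
\<close>

definition induced_map :: "(nat \<times> nat \<Rightarrow> nat \<times> nat) \<Rightarrow> int \<Rightarrow> int" where
  "induced_map f = (\<lambda>x\<in>carrier R. int (fst (f (nat x, 0))) mod int p)"

lemma twisted_affine_mod_p:
  assumes "twisted_affine p m U" "x < p\<^sup>2"
  shows "[int (U x) = m * int x + int (U 0)] (mod int p)"
proof -
  have "[int (U x) - int (U 0) = m * (int x - int 0)] (mod int p)"
    using assms unfolding twisted_affine_def by (metis gr_zeroI not_less_zero)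
  from cong_add[OF this cong_refl[of "int (U 0)"]] show ?thesis by simp
qed

lemma induced_map_diagonal_action:
  assumes U: "twisted_affine p m U"
  shows "induced_map (diagonal_action (p\<^sup>2) U) = affine m (int (U 0))"
proof (rule extensionalityI[where A = "carrier R"])
  fix x assume x: "x \<in> carrier R"
  then have "nat x < p" using p_ge_2 by (auto simp: carrier_R)
  then have lt: "nat x < p\<^sup>2" using p_le_square by linarith
  have "[int (U (nat x)) = m * int (nat x) + int (U 0)] (mod int p)"
    by (rule twisted_affine_mod_p[OF U lt])
  then show "induced_map (diagonal_action (p\<^sup>2) U) x = affine m (int (U 0)) x"
    using x lt by (simp add: induced_map_def affine_def diagonal_action_apply cong_def carrier_R)
qed (simp_all add: induced_map_def affine_def)

lemma induced_map_hom: "induced_map \<in> hom A (BijGroup (carrier R))"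
proof (rule homI)
  fix f assume "f \<in> carrier A"
  then obtain m U where "twisted_affine p m U" "f = diagonal_action (p\<^sup>2) U"
    using aut_is_diagonal_action by (metis carrier_A)
  then show "induced_map f \<in> carrier (BijGroup (carrier R))"
    by (simp add: induced_map_diagonal_action BijGroup_def affine_Bij twisted_affine_unit)
next
  fix f g assume "f \<in> carrier A" "g \<in> carrier A"
  then obtain m U n W where U: "twisted_affine p m U" "f = diagonal_action (p\<^sup>2) U"
    and W: "twisted_affine p n W" "g = diagonal_action (p\<^sup>2) W"
    using aut_is_diagonal_action by (metis carrier_A)
  have k0: "0 < p\<^sup>2" using p_ge_2 by simp
  have Wk: "W x < p\<^sup>2" if "x < p\<^sup>2" for x
    using W that by (auto simp: twisted_affine_def)
  have "induced_map (f \<otimes>\<^bsub>A\<^esub> g) = affine (m * n) (m * int (W 0) + int (U 0))"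
  proof (rule extensionalityI[where A = "carrier R"])
    fix x assume x: "x \<in> carrier R"
    then have "nat x < p" using p_ge_2 by (auto simp: carrier_R)
    then have lt: "nat x < p\<^sup>2" using p_le_square by linarith
    have "[int (U (W (nat x))) = m * int (W (nat x)) + int (U 0)] (mod int p)"
      by (rule twisted_affine_mod_p[OF U(1) Wk[OF lt]])
    also have "[m * int (W (nat x)) + int (U 0) = m * (n * int (nat x) + int (W 0)) + int (U 0)] (mod int p)"
      by (intro cong_add cong_mult cong_refl twisted_affine_mod_p[OF W(1) lt])
    finally have "[int (U (W (nat x))) = m * (n * int (nat x) + int (W 0)) + int (U 0)] (mod int p)" .
    then show "induced_map (f \<otimes>\<^bsub>A\<^esub> g) x = affine (m * n) (m * int (W 0) + int (U 0)) x"
      using x lt k0 U W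
      by (simp add: mult_diagonal_action induced_map_def affine_def diagonal_action_apply compose_eq
          cong_def carrier_R algebra_simps)
  qed (simp_all add: induced_map_def affine_def)
  also have "\<dots> = compose (carrier R) (induced_map f) (induced_map g)"
    using U W by (simp add: induced_map_diagonal_action compose_affine)
  also have "\<dots> = induced_map f \<otimes>\<^bsub>BijGroup (carrier R)\<^esub> induced_map g"
    using U W
    by (simp add: induced_map_diagonal_action BijGroup_mult affine_Bij twisted_affine_unit)
  finally show "induced_map (f \<otimes>\<^bsub>A\<^esub> g) = induced_map f \<otimes>\<^bsub>BijGroup (carrier R)\<^esub> induced_map g" .
qed


section \<open>Lifting affine maps without carry\<close>

text \<open>
  The low digit is moved by \<open>g\<close>, the high digit is multiplied by the square of the slope of \<open>g\<close>,
  and the carry from the low digit is dropped.  Keeping the carry would give an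
  element of order \<open>p\<^sup>2\<close> for \<open>x \<mapsto> x + 1\<close>, and no homomorphism.
\<close>

definition carry_free_lift :: "(int \<Rightarrow> int) \<Rightarrow> nat \<Rightarrow> nat" where
  "carry_free_lift g = (\<lambda>x\<in>{..<p\<^sup>2}. nat (g (int (x mod p))) +
     p * nat ((g 1 - g 0)\<^sup>2 * int (x div p) mod int p))"

lemma square_lessE: assumes "x < p\<^sup>2" shows "x div p < p"
  using assms by (simp add: less_mult_imp_div_less power2_eq_square)

lemma affine_slope: "[affine m b 1 - affine m b 0 = m] (mod int p)"
proof -
  have "[(m * 1 + b) mod int p - (m * 0 + b) mod int p = (m * 1 + b) - (m * 0 + b)] (mod int p)"
    by (intro cong_diff) (simp_all add: cong_def)
  then show ?thesis using p_ge_2 by (simp add: affine_apply)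
qed

lemma carry_free_lift_affine:
  assumes "x < p\<^sup>2"
  shows "carry_free_lift (affine m b) x = nat ((m * int (x mod p) + b) mod int p) +
           p * nat ((m\<^sup>2 * int (x div p)) mod int p)"
proof -
  have "[(affine m b 1 - affine m b 0)\<^sup>2 * int (x div p) = m\<^sup>2 * int (x div p)] (mod int p)"
    by (intro cong_mult cong_pow affine_slope cong_refl)
  moreover have "int (x mod p) < int p" using p_ge_2 by simp
  ultimately show ?thesis
    using assms by (simp add: carry_free_lift_def affine_apply cong_def del: zmod_int of_nat_mod)
qed

lemma nat_mod_less: "nat (z mod int p) < p"
  using p_ge_2 by (simp add: nat_less_iff)

lemma two_digits_less: "a < p \<Longrightarrow> t < p \<Longrightarrow> a + p * t < p\<^sup>2"
proof -
  assume "a < p" "t < p"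
  then have "a + p * t < p * (t + 1)" "p * (t + 1) \<le> p * p"
    by (simp add: algebra_simps) (intro mult_le_mono2, use \<open>t < p\<close> in simp)
  then show ?thesis unfolding power2_eq_square by linarith
qed

lemma carry_free_lift_less: "x < p\<^sup>2 \<Longrightarrow> carry_free_lift (affine m b) x < p\<^sup>2"
  by (simp add: carry_free_lift_affine two_digits_less nat_mod_less)

lemma carry_free_lift_twisted_affine:
  assumes m: "\<not> int p dvd m"
  shows "twisted_affine p m (carry_free_lift (affine m b))"
proof -
  let ?s = "carry_free_lift (affine m b)"
  have ints: "int (?s x) = (m * int (x mod p) + b) mod int p + int p * ((m\<^sup>2 * int (x div p)) mod int p)"
    if "x < p\<^sup>2" for x
    using that p_ge_2 by (simp add: carry_free_lift_affine)
  have modp: "[int (?s x) = m * int x + b] (mod int p)" if "x < p\<^sup>2" for x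
    unfolding ints[OF that] by (simp add: cong_def zmod_int mod_affine)
  show ?thesis
    unfolding twisted_affine_def
  proof (intro conjI allI impI)
    show "?s \<in> extensional {..<p\<^sup>2}" by (simp add: carry_free_lift_def)
    show "?s \<in> {..<p\<^sup>2} \<rightarrow> {..<p\<^sup>2}" using carry_free_lift_less by auto
    show "\<not> int p dvd m" by (rule m)
  next
    fix x y assume "x < p\<^sup>2" "y < p\<^sup>2"
    then have "[int (?s y) - int (?s x) = (m * int y + b) - (m * int x + b)] (mod int p)"
      by (intro cong_diff modp)
    then show "[int (?s y) - int (?s x) = m * (int y - int x)] (mod int p)"
      by (simp add: algebra_simps)
  next
    fix x y assume xy: "x < p\<^sup>2" "y < p\<^sup>2" "[int x = int y] (mod int p)"
    then have eq: "x mod p = y mod p" by (metis cong_def cong_int_iff)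
    define s t where "s = int (x div p)" and "t = int (y div p)"
    define a where "a = y mod p"
    have X: "int x = int a + int p * s"
      unfolding s_def a_def eq[symmetric] by (metis mod_mult_div_eq of_nat_add of_nat_mult)
    have Y: "int y = int a + int p * t"
      unfolding t_def a_def by (metis mod_mult_div_eq of_nat_add of_nat_mult)
    have yx: "int y - int x = int p * (t - s)"
      unfolding X Y by (simp add: right_diff_distrib)
    have "[(m\<^sup>2 * t) mod int p - (m\<^sup>2 * s) mod int p = m\<^sup>2 * t - m\<^sup>2 * s] (mod int p)"
      by (intro cong_diff) (simp_all add: cong_def)
    then have "(int p)\<^sup>2 dvd int p * (((m\<^sup>2 * t) mod int p - (m\<^sup>2 * s) mod int p) - (m\<^sup>2 * t - m\<^sup>2 * s))"
      using p_ge_2 by (simp add: square_dvd_mult_cancel cong_iff_dvd_diff)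
    also have "int p * (((m\<^sup>2 * t) mod int p - (m\<^sup>2 * s) mod int p) - (m\<^sup>2 * t - m\<^sup>2 * s)) =
       (int (?s y) - int (?s x)) - m\<^sup>2 * (int y - int x)"
      unfolding yx ints[OF xy(1)] ints[OF xy(2)] eq s_def[symmetric] t_def[symmetric]
      by (simp add: algebra_simps)
    finally show "[int (?s y) - int (?s x) = m\<^sup>2 * (int y - int x)] (mod (int p)\<^sup>2)"
      by (simp add: cong_iff_dvd_diff)
  qed
qed

lemma carry_free_lift_compose:
  "carry_free_lift (compose (carrier R) (affine m b) (affine n c)) =
   compose {..<p\<^sup>2} (carry_free_lift (affine m b)) (carry_free_lift (affine n c))"
proof (rule extensionalityI[where A = "{..<p\<^sup>2}"])
  fix x assume "x \<in> {..<p\<^sup>2}"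
  then have x: "x < p\<^sup>2" by simp
  define a where "a = nat ((n * int (x mod p) + c) mod int p)"
  define t where "t = nat ((n\<^sup>2 * int (x div p)) mod int p)"
  have ia: "int a = (n * int (x mod p) + c) mod int p" and it: "int t = (n\<^sup>2 * int (x div p)) mod int p"
    using p_ge_2 by (simp_all add: a_def t_def)
  have a: "a < p" by (simp add: a_def nat_mod_less)
  have s: "carry_free_lift (affine n c) x = a + p * t"
    using x by (simp add: carry_free_lift_affine a_def t_def)
  have st: "a + p * t < p\<^sup>2" using carry_free_lift_less[OF x, of n c] s by simp
  have "(m * int a + b) mod int p = (m * n * int (x mod p) + (m * c + b)) mod int p"
    unfolding ia by (simp add: mod_affine) (simp add: algebra_simps)
  moreover have "(m\<^sup>2 * int t) mod int p = ((m * n)\<^sup>2 * int (x div p)) mod int p"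
    unfolding it by (simp add: mod_simps power_mult_distrib mult.assoc)
  ultimately show "carry_free_lift (compose (carrier R) (affine m b) (affine n c)) x =
      compose {..<p\<^sup>2} (carry_free_lift (affine m b)) (carry_free_lift (affine n c)) x"
    using x a st by (simp add: compose_eq s compose_affine carry_free_lift_affine)
qed (simp_all add: carry_free_lift_def compose_def)

abbreviation "lift_aut g \<equiv> diagonal_action (p\<^sup>2) (carry_free_lift g)"

lemma lift_aut_in_A: "g \<in> affine_maps R \<Longrightarrow> lift_aut g \<in> carrier A"
  using carry_free_lift_twisted_affine diagonal_action_in_A by (fastforce simp: affine_maps_R)

lemma induced_map_lift_aut:
  assumes "g \<in> affine_maps R"
  shows "induced_map (lift_aut g) = g"
proof -
  obtain m b where g: "g = affine m b" "\<not> int p dvd m"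
    using assms by (auto simp: affine_maps_R)
  have "int (carry_free_lift g 0) = b mod int p"
    using p_ge_2 by (simp add: g carry_free_lift_affine)
  then have "induced_map (lift_aut g) = affine m (b mod int p)"
    using induced_map_diagonal_action[OF carry_free_lift_twisted_affine[OF g(2)]] g by simp
  also have "\<dots> = g" unfolding g by (rule affine_cong) (simp_all add: cong_def)
  finally show ?thesis .
qed

text \<open>
  As the image of a homomorphism into the group of bijections, the affine maps form a group; this
  saves a computation of inverses.
\<close>

lemma induced_map_image: "induced_map ` carrier A = affine_maps R"
proof (intro equalityI subsetI)
  fix g assume "g \<in> induced_map ` carrier A"
  then obtain f where f: "f \<in> digraph_auts G" "g = induced_map f"
    using carrier_A by blast
  from f(1) obtain m U where "twisted_affine p m U" "f = diagonal_action (p\<^sup>2) U"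
    by (rule aut_is_diagonal_action)
  then have "twisted_affine p m U" "g = affine m (int (U 0))"
    using f(2) by (simp_all add: induced_map_diagonal_action)
  then show "g \<in> affine_maps R" by (auto simp: affine_maps_R twisted_affine_def)
next
  fix g assume "g \<in> affine_maps R"
  then show "g \<in> induced_map ` carrier A"
    using induced_map_lift_aut lift_aut_in_A by (metis image_eqI)
qed

lemma carrier_Aff: "carrier (Aff R) = affine_maps R"
  by (simp add: Aff_def)

lemma group_Aff: "group (Aff R)"
proof -
  interpret group_hom A "BijGroup (carrier R)" induced_map
    using group_A group_BijGroup induced_map_hom by (simp add: group_hom_def group_hom_axioms_def)
  show ?thesis
    using img_is_subgroup unfolding induced_map_image Aff_def by (rule H.subgroup_imp_group)
qed

lemma mult_Aff: "g \<otimes>\<^bsub>Aff R\<^esub> h = g \<otimes>\<^bsub>BijGroup (carrier R)\<^esub> h"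
  by (simp add: Aff_def)

lemma induced_map_hom_Aff: "induced_map \<in> hom A (Aff R)"
  using induced_map_hom induced_map_image by (auto simp: hom_def carrier_Aff mult_Aff)

lemma lift_aut_hom: "lift_aut \<in> hom (Aff R) A"
proof (rule homI)
  fix g assume "g \<in> carrier (Aff R)"
  then show "lift_aut g \<in> carrier A" by (simp add: carrier_Aff lift_aut_in_A)
next
  fix g h assume "g \<in> carrier (Aff R)" "h \<in> carrier (Aff R)"
  then obtain m b n c where g: "g = affine m b" "\<not> int p dvd m" and h: "h = affine n c" "\<not> int p dvd n"
    by (auto simp: carrier_Aff affine_maps_R)
  have "g \<otimes>\<^bsub>Aff R\<^esub> h = compose (carrier R) g h"
    using g h by (simp add: mult_Aff BijGroup_mult affine_Bij)
  then have "lift_aut (g \<otimes>\<^bsub>Aff R\<^esub> h) =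
      diagonal_action (p\<^sup>2) (compose {..<p\<^sup>2} (carry_free_lift g) (carry_free_lift h))"
    using g h by (simp add: carry_free_lift_compose)
  also have "\<dots> = lift_aut g \<otimes>\<^bsub>A\<^esub> lift_aut h"
    using g h by (simp add: mult_diagonal_action[OF carry_free_lift_twisted_affine carry_free_lift_twisted_affine])
  finally show "lift_aut (g \<otimes>\<^bsub>Aff R\<^esub> h) = lift_aut g \<otimes>\<^bsub>A\<^esub> lift_aut h" .
qed


section \<open>The kernel of the reduction\<close>

text \<open>The residue classes modulo \<open>p\<close> are the fibres of the reduction, and each of them is rotated separately.\<close>

definition fibre_shift :: "(nat \<Rightarrow> nat) \<Rightarrow> nat \<Rightarrow> nat" where
  "fibre_shift \<alpha> = (\<lambda>x\<in>{..<p\<^sup>2}. (x + p * \<alpha> (x mod p)) mod p\<^sup>2)"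

abbreviation "shift_aut \<alpha> \<equiv> diagonal_action (p\<^sup>2) (fibre_shift \<alpha>)"

lemma fibre_shift_mod: "x < p\<^sup>2 \<Longrightarrow> fibre_shift \<alpha> x mod p = x mod p"
  by (simp add: fibre_shift_def mod_mod_cancel)

lemma fibre_shift_twisted_affine: "twisted_affine p 1 (fibre_shift \<alpha>)"
proof -
  have k0: "0 < p\<^sup>2" using p_ge_2 by simp
  have modp: "[int (fibre_shift \<alpha> x) = int x] (mod int p)" if "x < p\<^sup>2" for x
    using fibre_shift_mod[OF that] by (simp add: cong_int_iff cong_def flip: of_nat_mod)
  have ints: "[int (fibre_shift \<alpha> x) = int x + int p * int (\<alpha> (x mod p))] (mod (int p)\<^sup>2)"
    if "x < p\<^sup>2" for x
    using that by (simp add: fibre_shift_def cong_def zmod_int)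
  show ?thesis
    unfolding twisted_affine_def
  proof (intro conjI allI impI)
    show "fibre_shift \<alpha> \<in> extensional {..<p\<^sup>2}" by (simp add: fibre_shift_def)
    show "fibre_shift \<alpha> \<in> {..<p\<^sup>2} \<rightarrow> {..<p\<^sup>2}" using k0 by (simp add: fibre_shift_def)
    show "\<not> int p dvd 1" using p_ge_2 by simp
  next
    fix x y assume "x < p\<^sup>2" "y < p\<^sup>2"
    then show "[int (fibre_shift \<alpha> y) - int (fibre_shift \<alpha> x) = 1 * (int y - int x)] (mod int p)"
      by (simp add: cong_diff modp)
  next
    fix x y assume xy: "x < p\<^sup>2" "y < p\<^sup>2" "[int x = int y] (mod int p)"
    then have "x mod p = y mod p" by (metis cong_def cong_int_iff)
    then show "[int (fibre_shift \<alpha> y) - int (fibre_shift \<alpha> x) = 1\<^sup>2 * (int y - int x)] (mod (int p)\<^sup>2)"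
      using cong_diff[OF ints[OF xy(2)] ints[OF xy(1)]] by simp
  qed
qed

lemmas shift_aut_in_A = diagonal_action_in_A[OF fibre_shift_twisted_affine]

lemma mult_shift_aut: "shift_aut \<alpha> \<otimes>\<^bsub>A\<^esub> shift_aut \<beta> = shift_aut (\<lambda>a. \<alpha> a + \<beta> a)"
proof -
  have k0: "0 < p\<^sup>2" using p_ge_2 by simp
  have "compose {..<p\<^sup>2} (fibre_shift \<alpha>) (fibre_shift \<beta>) = fibre_shift (\<lambda>a. \<alpha> a + \<beta> a)"
  proof (rule extensionalityI[where A = "{..<p\<^sup>2}"])
    fix x assume "x \<in> {..<p\<^sup>2}"
    then have x: "x < p\<^sup>2" by simp
    have "fibre_shift \<beta> x < p\<^sup>2" using k0 x by (simp add: fibre_shift_def)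
    then have "fibre_shift \<alpha> (fibre_shift \<beta> x) = (fibre_shift \<beta> x + p * \<alpha> (fibre_shift \<beta> x mod p)) mod p\<^sup>2"
      by (simp add: fibre_shift_def)
    also have "\<dots> = ((x + p * \<beta> (x mod p)) mod p\<^sup>2 + p * \<alpha> (x mod p)) mod p\<^sup>2"
      using x by (simp only: fibre_shift_mod) (simp add: fibre_shift_def)
    also have "\<dots> = fibre_shift (\<lambda>a. \<alpha> a + \<beta> a) x"
      using x by (simp add: fibre_shift_def mod_simps algebra_simps)
    finally show "compose {..<p\<^sup>2} (fibre_shift \<alpha>) (fibre_shift \<beta>) x = fibre_shift (\<lambda>a. \<alpha> a + \<beta> a) x"
      using x by (simp add: compose_eq)
  qed (simp_all add: fibre_shift_def compose_def)
  then show ?thesis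
    by (simp add: mult_diagonal_action[OF fibre_shift_twisted_affine fibre_shift_twisted_affine])
qed

lemma shift_aut_one:
  assumes "\<And>a. p dvd \<alpha> a"
  shows "shift_aut \<alpha> = \<one>\<^bsub>A\<^esub>"
proof -
  have "(x + p * \<alpha> (x mod p)) mod p\<^sup>2 = x" if "x < p\<^sup>2" for x
  proof -
    obtain c where c: "\<alpha> (x mod p) = p * c" using assms by blast
    show ?thesis using that unfolding c by (simp add: power2_eq_square flip: mult.assoc)
  qed
  then have id: "fibre_shift \<alpha> x = x" if "x < p\<^sup>2" for x
    using that by (simp add: fibre_shift_def)
  show ?thesis
    unfolding one_A
  proof (rule extensionalityI[where A = V])
    fix x assume "x \<in> V"
    then obtain u i where x: "x = (u, i)" "u < p\<^sup>2" "i < p\<^sup>2" by auto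
    have "((u + i) mod p\<^sup>2 + (p\<^sup>2 - u)) mod p\<^sup>2 = ((u + i) + (p\<^sup>2 - u)) mod p\<^sup>2"
      by (rule mod_add_left_eq)
    also have "(u + i) + (p\<^sup>2 - u) = i + p\<^sup>2" using x by simp
    finally have "((u + i) mod p\<^sup>2 + (p\<^sup>2 - u)) mod p\<^sup>2 = i" using x by simp
    moreover have "(u + i) mod p\<^sup>2 < p\<^sup>2" using p_ge_2 by simp
    ultimately show "shift_aut \<alpha> x = (\<lambda>x\<in>V. x) x"
      using x by (simp add: diagonal_action_apply id)
  qed (simp_all add: diagonal_action_in_extensional)
qed

lemma pow_shift_aut: "shift_aut \<alpha> [^]\<^bsub>A\<^esub> (n::nat) = shift_aut (\<lambda>a. n * \<alpha> a)"
proof (induction n)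
  case 0
  show ?case by (simp add: shift_aut_one)
next
  case (Suc n)
  then show ?case by (simp add: mult_shift_aut add.commute)
qed

abbreviation "N \<equiv> kernel A (Aff R) induced_map"

text \<open>
  An element of the kernel has \<open>m \<equiv> 1\<close>, so it is determined by its values on \<open>{..<p}\<close>, and there it
  changes the high digit only: \<open>U a = a + p (U a div p)\<close>.  The description by all functions \<open>\<alpha>\<close> suits
  computation, the one by functions with values below \<open>p\<close> suits counting.
\<close>

lemma kernel_eq_range: "N = range shift_aut"
  and kernel_eq_image: "N = shift_aut ` ({..<p} \<rightarrow>\<^sub>E {..<p})"
proof -
  have one: "\<one>\<^bsub>Aff R\<^esub> = affine 1 0"
    unfolding Aff_def BijGroup_def affine_def by (simp add: carrier_R cong: restrict_cong)
  have "shift_aut \<alpha> \<in> N" for \<alpha>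
  proof -
    have "[int (fibre_shift \<alpha> 0) = 0] (mod int p)"
    proof -
      have "fibre_shift \<alpha> 0 mod p = 0 mod p" using p_ge_2 by (intro fibre_shift_mod) simp
      then show ?thesis by (simp add: cong_def flip: of_nat_mod)
    qed
    then have "induced_map (shift_aut \<alpha>) = affine 1 0"
      by (simp add: induced_map_diagonal_action[OF fibre_shift_twisted_affine] affine_cong)
    then show ?thesis by (simp add: kernel_def one shift_aut_in_A)
  qed
  then have 1: "range shift_aut \<subseteq> N" by blast
  have 2: "N \<subseteq> shift_aut ` ({..<p} \<rightarrow>\<^sub>E {..<p})"
  proof
    fix f assume f: "f \<in> N"
    then have "f \<in> digraph_auts G" by (simp add: kernel_def carrier_A)
    then obtain m U where U: "twisted_affine p m U" "f = diagonal_action (p\<^sup>2) U"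
      by (rule aut_is_diagonal_action)
    have k0: "0 < p\<^sup>2" using p_ge_2 by simp
    have "affine m (int (U 0)) = affine 1 0"
      using f U by (simp add: kernel_def one induced_map_diagonal_action)
    from affine_eqD[OF this] have m1: "[m = 1] (mod int p)" and U0: "[int (U 0) = 0] (mod int p)" .
    have Ump: "U x mod p = x mod p" if "x < p\<^sup>2" for x
    proof -
      have "[int (U x) = m * int x + int (U 0)] (mod int p)" by (rule twisted_affine_mod_p[OF U(1) that])
      also have "[m * int x + int (U 0) = 1 * int x + 0] (mod int p)"
        by (intro cong_add cong_mult m1 U0 cong_refl)
      finally have "[int (U x) = int x] (mod int p)" by simp
      then have "[U x = x] (mod p)" by (simp only: cong_int_iff)
      then show ?thesis by (simp only: cong_def)
    qed
    define \<alpha> where "\<alpha> = (\<lambda>a\<in>{..<p}. U a div p)"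
    have "\<alpha> \<in> {..<p} \<rightarrow>\<^sub>E {..<p}"
    proof -
      have "U a div p < p" if "a < p" for a
      proof -
        have "a < p\<^sup>2" using that p_le_square by linarith
        then have "U a < p\<^sup>2" using U by (auto simp: twisted_affine_def)
        then show ?thesis by (rule square_lessE)
      qed
      then show ?thesis by (auto simp: \<alpha>_def)
    qed
    moreover have "U = fibre_shift \<alpha>"
    proof (rule extensionalityI[where A = "{..<p\<^sup>2}"])
      show "U \<in> extensional {..<p\<^sup>2}" using U by (simp add: twisted_affine_def)
      show "fibre_shift \<alpha> \<in> extensional {..<p\<^sup>2}" by (simp add: fibre_shift_def)
      fix x assume "x \<in> {..<p\<^sup>2}"
      then have x: "x < p\<^sup>2" by simp
      define a where "a = x mod p"
      have a: "a < p" using p_ge_2 by (simp add: a_def)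
      then have ak: "a < p\<^sup>2" using p_le_square by linarith
      have "[a = x] (mod p)" by (simp add: a_def cong_def)
      then have ax: "[int a = int x] (mod int p)" by (simp only: cong_int_iff)
      have "[int (U x) - int (U a) = m\<^sup>2 * (int x - int a)] (mod (int p)\<^sup>2)"
        using U(1) x ak ax unfolding twisted_affine_def by blast
      moreover have "[m\<^sup>2 * (int x - int a) = int x - int a] (mod (int p)\<^sup>2)"
      proof -
        have "int p dvd int x - int a" using ax by (simp add: cong_iff_dvd_diff dvd_diff_commute)
        moreover have "[m\<^sup>2 = 1\<^sup>2] (mod int p)" by (intro cong_pow m1)
        then have "int p dvd m\<^sup>2 - 1" by (simp add: cong_iff_dvd_diff)
        ultimately have "int p * int p dvd (m\<^sup>2 - 1) * (int x - int a)" by (intro mult_dvd_mono)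
        then show ?thesis by (simp add: cong_iff_dvd_diff algebra_simps power2_eq_square)
      qed
      ultimately have "[int (U x) - int (U a) = int x - int a] (mod (int p)\<^sup>2)" by (rule cong_trans)
      from cong_add[OF this cong_refl[of "int (U a)"]]
      have "[int (U x) = int x - int a + int (U a)] (mod (int p)\<^sup>2)" by simp
      also have "U a = a + p * \<alpha> a"
      proof -
        have "U a mod p = a" using Ump[OF ak] a by simp
        moreover have "U a = U a mod p + p * (U a div p)" by simp
        ultimately show ?thesis using a by (simp add: \<alpha>_def)
      qed
      also have "int x - int a + int (a + p * \<alpha> a) = int (x + p * \<alpha> (x mod p))"
        by (simp add: a_def)
      finally have "[int (U x) = int (x + p * \<alpha> (x mod p))] (mod int (p\<^sup>2))" by simp
      then have "[U x = x + p * \<alpha> (x mod p)] (mod p\<^sup>2)" by (simp only: cong_int_iff)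
      moreover have "U x < p\<^sup>2" using U x by (auto simp: twisted_affine_def)
      ultimately show "U x = fibre_shift \<alpha> x" using x by (simp add: fibre_shift_def cong_def)
    qed
    ultimately show "f \<in> shift_aut ` ({..<p} \<rightarrow>\<^sub>E {..<p})" using U by blast
  qed
  show "N = range shift_aut" "N = shift_aut ` ({..<p} \<rightarrow>\<^sub>E {..<p})"
    using 1 2 by blast+
qed

lemma card_kernel: "card N = p ^ p"
proof -
  have "inj_on shift_aut ({..<p} \<rightarrow>\<^sub>E {..<p})"
  proof (rule inj_onI)
    fix \<alpha> \<beta> assume ab: "\<alpha> \<in> {..<p} \<rightarrow>\<^sub>E {..<p}" "\<beta> \<in> {..<p} \<rightarrow>\<^sub>E {..<p}" "shift_aut \<alpha> = shift_aut \<beta>"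
    have k0: "0 < p\<^sup>2" using p_ge_2 by simp
    have val: "fst (shift_aut \<gamma> (a, 0)) = a + p * \<gamma> a" if "a < p" "\<gamma> \<in> {..<p} \<rightarrow>\<^sub>E {..<p}" for \<gamma> a
    proof -
      have "\<gamma> a < p" using that by auto
      moreover have "a < p\<^sup>2" using that p_le_square by linarith
      ultimately show ?thesis
        using that two_digits_less[of a "\<gamma> a"] k0 by (simp add: diagonal_action_apply fibre_shift_def)
    qed
    have "\<alpha> a = \<beta> a" if "a < p" for a
      using val[OF that ab(1)] val[OF that ab(2)] ab(3) p_ge_2 by simp
    then show "\<alpha> = \<beta>" using ab(1,2) by (auto intro: PiE_ext)
  qed
  then show ?thesis by (simp add: kernel_eq_image card_image card_PiE)
qed

lemma kernel_elementary_abelian: "elementary_abelian p (A\<lparr>carrier := N\<rparr>)"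
proof (rule elementary_abelianI)
  interpret group A by (rule group_A)
  interpret group_hom A "Aff R" induced_map
    using group_A group_Aff induced_map_hom_Aff by (simp add: group_hom_def group_hom_axioms_def)
  show "group (A\<lparr>carrier := N\<rparr>)"
    by (rule group.subgroup_imp_group[OF group_A subgroup_kernel])
  show "prime p" by (rule prime_p)
  show "x \<otimes>\<^bsub>A\<lparr>carrier := N\<rparr>\<^esub> y = y \<otimes>\<^bsub>A\<lparr>carrier := N\<rparr>\<^esub> x"
    if "x \<in> carrier (A\<lparr>carrier := N\<rparr>)" "y \<in> carrier (A\<lparr>carrier := N\<rparr>)" for x y
    using that by (auto simp: kernel_eq_range mult_shift_aut add.commute)
  show "x [^]\<^bsub>A\<lparr>carrier := N\<rparr>\<^esub> p = \<one>\<^bsub>A\<lparr>carrier := N\<rparr>\<^esub>" if x: "x \<in> carrier (A\<lparr>carrier := N\<rparr>)" for x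
  proof -
    obtain \<alpha> where "x = shift_aut \<alpha>" using x by (auto simp: kernel_eq_range)
    then have "x [^]\<^bsub>A\<^esub> p = \<one>\<^bsub>A\<^esub>" by (simp add: pow_shift_aut shift_aut_one)
    then show ?thesis
      using monoid.nat_pow_consistent[OF group.is_monoid[OF group_A], of x p N] by simp
  qed
qed

text \<open>
  For \<open>p = 2\<close> the quotient is abelian, so non-commutativity has to come from the action on the
  kernel: the lift of \<open>x \<mapsto> x + 1\<close> moves the fibre of \<open>0\<close>, which alone is rotated by \<open>e\<close>.
\<close>

lemma A_not_comm: "\<not> comm_group A"
proof
  assume "comm_group A"
  then interpret comm_group A .
  define e where "e = shift_aut (\<lambda>a. if a = 0 then 1 else 0)"
  define t where "t = lift_aut (affine 1 1)"
  have "1 < p" using p_ge_2 by simp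
  then have p1: "1 < p" "p < p\<^sup>2" by (simp_all add: power2_eq_square)
  then have k: "0 < p\<^sup>2" "1 < p\<^sup>2" by linarith+
  have et: "e \<in> carrier A" "t \<in> carrier A"
    using p_ge_2 carry_free_lift_twisted_affine[of 1 1]
    by (auto simp: e_def t_def shift_aut_in_A diagonal_action_in_A)
  have "fst ((t \<otimes>\<^bsub>A\<^esub> e) (0, 0)) = p + 1"
    using p1 k et by (simp add: mult_A compose_eq)
      (simp add: e_def t_def diagonal_action_apply fibre_shift_def carry_free_lift_affine)
  moreover have "fst ((e \<otimes>\<^bsub>A\<^esub> t) (0, 0)) = 1"
    using p1 k et by (simp add: mult_A compose_eq)
      (simp add: e_def t_def diagonal_action_apply fibre_shift_def carry_free_lift_affine)
  ultimately show False using m_comm[OF et] p1 by simp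
qed

end


section \<open>The semidirect product\<close>

theorem theorem7:
  fixes p :: nat
  assumes "prime p"
  shows "let A = digraph_AutGroup (residue_digraph (p\<^sup>2) p (1 + p)) in
    group A \<and> \<not> comm_group A \<and> order A = p ^ (p + 1) * (p - 1) \<and>
    (\<exists>N H. N \<lhd> A \<and> subgroup H A \<and>
       N \<inter> H = {\<one>\<^bsub>A\<^esub>} \<and> N <#>\<^bsub>A\<^esub> H = carrier A \<and>
       elementary_abelian p (A\<lparr>carrier := N\<rparr>) \<and> card N = p ^ p \<and>
       card H = p * (p - 1) \<and> A\<lparr>carrier := H\<rparr> \<cong> Aff (residue_ring (int p)))"
proof -
  interpret prime_residue_digraph p by unfold_locales (rule assms)
  have sect: "\<forall>g\<in>carrier (Aff R). induced_map (lift_aut g) = g"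
    by (simp add: carrier_Aff induced_map_lift_aut)
  note split = split_epimorphism_semidirect[where \<phi> = induced_map and s = lift_aut,
    OF group_A group_Aff induced_map_hom_Aff lift_aut_hom sect]
  have Aff: "order (Aff R) = p * (p - 1)"
    by (simp add: order_def carrier_Aff card_affine_maps)
  have "order A = p ^ (p + 1) * (p - 1)"
    using split(7) by (simp add: Aff card_kernel)
  then show ?thesis
    unfolding Let_def A_def[unfolded G_def, symmetric]
    \<comment> \<open>The witnesses are the kernel of the reduction and the image of the carry-free lift.\<close>
    using group_A A_not_comm split(1-6) kernel_elementary_abelian card_kernel Aff by metis
qed

end
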